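(* Let $\rho$ be a $d$-dimensional complex representation of $\mathcal{B}_3$ with $\rho(\sigma_1)=A$ and $\rho(\sigma_2)=B$, such that the minimal and characteristic polynomials of $A$ (and of $B$) agree and such that no eigenvalue of $A$ is the negation of another. Suppose that $\rho$ admits a standard extension to $\mathcal{LB}_3$. Then there are only finitely many extensions of $\rho$ to $\mathcal{LB}_3$ that factor through $\mathcal{SLB}_3$.
   Context: $\mathcal{B}_3=\langle \sigma_1,\sigma_2 : \sigma_1\sigma_2\sigma_1=\sigma_2\sigma_1\sigma_2\rangle$ is the braid group. The three component loop braid group $\mathcal{LB}_3$ is the group generated by $\sigma_1,\sigma_2,s_1,s_2$ with relations $\sigma_1\sigma_2\sigma_1=\sigma_2\sigma_1\sigma_2$; $s_1s_2s_1=s_2s_1s_2$; $s_1^2=s_2^2=1$; $s_1s_2\sigma_1=\sigma_2s_1s_2$; $\sigma_1\sigma_2s_1=s_2\sigma_1\sigma_2$. The symmetric loop braid group $\mathcal{SLB}_3$ is the quotient of $\mathcal{LB}_3$ by the additional relation $\sigma_2\sigma_1s_2=s_1\sigma_2\sigma_1$. An extension of a representation $\rho$ of $\mathcal{B}_3$ on $V$ to $\mathcal{LB}_3$ is a representation of $\mathcal{LB}_3$ on the same space $V$ with the same values on $\sigma_1,\sigma_2$. It is a standard extension if $\rho(s_1s_2)=k\rho(\sigma_1\sigma_2)$ for some $k\in\mathbb{C}$. *)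

theory Defs
  imports "HOL-Algebra.Coset" "Jordan_Normal_Form.Char_Poly"
begin

text \<open>Groups given by generators and relations. The letter \<open>(g, True)\<close> stands for the
  generator \<open>g\<close> and \<open>(g, False)\<close> for its formal inverse; a relation \<open>u = v\<close> is the pair \<open>(u, v)\<close>.\<close>

type_synonym 'g word = "('g \<times> bool) list"

inductive_set word_cong :: "('g word \<times> 'g word) set \<Rightarrow> ('g word \<times> 'g word) set"
  for R :: "('g word \<times> 'g word) set" where
  rel: "(u, v) \<in> R \<Longrightarrow> (u, v) \<in> word_cong R"
| cancel: "([(g, b), (g, \<not> b)], []) \<in> word_cong R"
| refl: "(u, u) \<in> word_cong R"
| sym: "(u, v) \<in> word_cong R \<Longrightarrow> (v, u) \<in> word_cong R"
| trans: "(u, v) \<in> word_cong R \<Longrightarrow> (v, w) \<in> word_cong R \<Longrightarrow> (u, w) \<in> word_cong R"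
| append: "(u, u') \<in> word_cong R \<Longrightarrow> (v, v') \<in> word_cong R \<Longrightarrow> (u @ v, u' @ v') \<in> word_cong R"

definition word_class :: "('g word \<times> 'g word) set \<Rightarrow> 'g word \<Rightarrow> 'g word set" where
  "word_class R w = word_cong R `` {w}"

definition presented_group :: "('g word \<times> 'g word) set \<Rightarrow> 'g word set monoid" where
  "presented_group R =
    \<lparr>carrier = UNIV // word_cong R,
     monoid.mult = (\<lambda>U V. \<Union>u\<in>U. \<Union>v\<in>V. word_class R (u @ v)),
     one = word_class R []\<rparr>"

definition gen :: "('g word \<times> 'g word) set \<Rightarrow> 'g \<Rightarrow> 'g word set" where
  "gen R g = word_class R [(g, True)]"

definition pos :: "'g list \<Rightarrow> 'g word" where
  "pos gs = map (\<lambda>g. (g, True)) gs"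

lemma equiv_word_cong: "equiv UNIV (word_cong R)"
proof (rule equivI)
  show "trans (word_cong R)" by (rule transI) (rule word_cong.trans)
  show "sym (word_cong R)" by (rule symI) (rule word_cong.sym)
qed (auto intro: refl_onI word_cong.refl)

lemma word_class_eq_iff: "word_class R u = word_class R v \<longleftrightarrow> (u, v) \<in> word_cong R"
  unfolding word_class_def by (simp add: eq_equiv_class_iff[OF equiv_word_cong])

lemma carrier_presented_group: "carrier (presented_group R) = range (word_class R)"
  by (auto simp: presented_group_def quotient_def word_class_def)

lemma mult_word_class:
  "word_class R u \<otimes>\<^bsub>presented_group R\<^esub> word_class R v = word_class R (u @ v)"
proof -
  have *: "word_class R (u' @ v') = word_class R (u @ v)"
    if "u' \<in> word_class R u" "v' \<in> word_class R v" for u' v'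
  proof -
    have "(u, u') \<in> word_cong R" "(v, v') \<in> word_cong R"
      using that by (simp_all add: word_class_def)
    then have "(u @ v, u' @ v') \<in> word_cong R" by (rule word_cong.append)
    then show ?thesis unfolding word_class_eq_iff by (rule word_cong.sym)
  qed
  have mem: "u \<in> word_class R u" "v \<in> word_class R v"
    unfolding word_class_def Image_singleton_iff by (rule word_cong.refl)+
  have "word_class R u \<otimes>\<^bsub>presented_group R\<^esub> word_class R v =
      (\<Union>u'\<in>word_class R u. \<Union>v'\<in>word_class R v. word_class R (u' @ v'))"
    by (simp add: presented_group_def)
  also have "\<dots> = (\<Union>u'\<in>word_class R u. \<Union>v'\<in>word_class R v. word_class R (u @ v))"
    by (intro SUP_cong HOL.refl *)
  also have "\<dots> = word_class R (u @ v)"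
    using mem by blast
  finally show ?thesis .
qed

lemma word_inverse: "(map (\<lambda>(g, b). (g, \<not> b)) (rev w) @ w, []) \<in> word_cong R"
proof (induction w)
  case Nil
  show ?case by (simp add: word_cong.refl)
next
  case (Cons a w)
  obtain g b where a: "a = (g, b)" by (cases a)
  let ?i = "map (\<lambda>(g, b). (g, \<not> b)) (rev w)"
  have "([(g, \<not> b), (g, b)], []) \<in> word_cong R"
    using word_cong.cancel[of g "\<not> b" R] by simp
  from word_cong.append[OF this word_cong.refl[of w]]
  have "(?i @ ([(g, \<not> b), (g, b)] @ w), ?i @ ([] @ w)) \<in> word_cong R"
    by (rule word_cong.append[OF word_cong.refl])
  then have "(map (\<lambda>(g, b). (g, \<not> b)) (rev (a # w)) @ a # w, ?i @ w) \<in> word_cong R"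
    by (simp add: a)
  from word_cong.trans[OF this Cons.IH] show ?case .
qed

lemma group_presented_group: "group (presented_group R)"
proof (rule groupI)
  have one: "\<one>\<^bsub>presented_group R\<^esub> = word_class R []" by (simp add: presented_group_def)
  show "\<one>\<^bsub>presented_group R\<^esub> \<in> carrier (presented_group R)"
    by (simp add: one carrier_presented_group)
  show "\<exists>y\<in>carrier (presented_group R). y \<otimes>\<^bsub>presented_group R\<^esub> x = \<one>\<^bsub>presented_group R\<^esub>"
    if "x \<in> carrier (presented_group R)" for x
  proof -
    obtain w where "x = word_class R w" using \<open>x \<in> _\<close> by (auto simp: carrier_presented_group)
    then show ?thesis using word_inverse[of w R]
      by (auto simp: carrier_presented_group mult_word_class one word_class_eq_iff)
  qed
  show "\<one>\<^bsub>presented_group R\<^esub> \<otimes>\<^bsub>presented_group R\<^esub> x = x"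
    if "x \<in> carrier (presented_group R)" for x
    using that by (auto simp: carrier_presented_group mult_word_class one)
qed (auto simp: carrier_presented_group mult_word_class)

definition normal_closure :: "('a, 'b) monoid_scheme \<Rightarrow> 'a set \<Rightarrow> 'a set" where
  "normal_closure G S = carrier G \<inter> \<Inter>{N. N \<lhd> G \<and> S \<subseteq> N}"

lemma (in group) normal_closure_normal:
  assumes "S \<subseteq> carrier G"
  shows "normal_closure G S \<lhd> G"
proof -
  let ?F = "{N. N \<lhd> G \<and> S \<subseteq> N}"
  have "carrier G \<in> ?F" using assms
    by (simp add: normal_inv_iff subgroup_self)
  then have "?F \<noteq> {}" and eq: "normal_closure G S = \<Inter>?F"
    unfolding normal_closure_def by blast+
  have sub: "subgroup (\<Inter>?F) G"
    by (rule subgroups_Inter) (use \<open>?F \<noteq> {}\<close> in \<open>auto dest: normal_imp_subgroup\<close>)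
  have "x \<otimes> h \<otimes> inv x \<in> \<Inter>?F" if "x \<in> carrier G" "h \<in> \<Inter>?F" for x h
    using that by (auto intro: normal.inv_op_closed2)
  with sub show ?thesis unfolding eq normal_inv_iff by blast
qed

datatype b3_gen = Sigma1 | Sigma2

definition B3_rels :: "(b3_gen word \<times> b3_gen word) set" where
  "B3_rels = {(pos [Sigma1, Sigma2, Sigma1], pos [Sigma2, Sigma1, Sigma2])}"

definition B3 :: "b3_gen word set monoid" where
  "B3 = presented_group B3_rels"

definition b3_sigma1 where "b3_sigma1 = gen B3_rels Sigma1"
definition b3_sigma2 where "b3_sigma2 = gen B3_rels Sigma2"

datatype lb3_gen = LSigma1 | LSigma2 | LS1 | LS2

definition LB3_rels :: "(lb3_gen word \<times> lb3_gen word) set" where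
  "LB3_rels =
    {(pos [LSigma1, LSigma2, LSigma1], pos [LSigma2, LSigma1, LSigma2]),
     (pos [LS1, LS2, LS1], pos [LS2, LS1, LS2]),
     (pos [LS1, LS1], []),
     (pos [LS2, LS2], []),
     (pos [LS1, LS2, LSigma1], pos [LSigma2, LS1, LS2]),
     (pos [LSigma1, LSigma2, LS1], pos [LS2, LSigma1, LSigma2])}"

definition LB3 :: "lb3_gen word set monoid" where
  "LB3 = presented_group LB3_rels"

definition lb3_sigma1 where "lb3_sigma1 = gen LB3_rels LSigma1"
definition lb3_sigma2 where "lb3_sigma2 = gen LB3_rels LSigma2"
definition lb3_s1 where "lb3_s1 = gen LB3_rels LS1"
definition lb3_s2 where "lb3_s2 = gen LB3_rels LS2"

definition SLB3_kernel :: "lb3_gen word set set" where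
  "SLB3_kernel = normal_closure LB3
    {(lb3_sigma2 \<otimes>\<^bsub>LB3\<^esub> lb3_sigma1 \<otimes>\<^bsub>LB3\<^esub> lb3_s2) \<otimes>\<^bsub>LB3\<^esub>
     inv\<^bsub>LB3\<^esub> (lb3_s1 \<otimes>\<^bsub>LB3\<^esub> lb3_sigma2 \<otimes>\<^bsub>LB3\<^esub> lb3_sigma1)}"

definition SLB3 :: "lb3_gen word set set monoid" where
  "SLB3 = LB3 Mod SLB3_kernel"

definition SLB3_proj :: "lb3_gen word set \<Rightarrow> lb3_gen word set set" where
  "SLB3_proj x = SLB3_kernel #>\<^bsub>LB3\<^esub> x"

lemma group_B3: "group B3"
  by (simp add: B3_def group_presented_group)

lemma group_LB3: "group LB3"
  by (simp add: LB3_def group_presented_group)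

lemma SLB3_kernel_normal: "SLB3_kernel \<lhd> LB3"
proof -
  interpret group LB3 by (rule group_LB3)
  have "{lb3_sigma1, lb3_sigma2, lb3_s1, lb3_s2} \<subseteq> carrier LB3"
    by (auto simp: LB3_def carrier_presented_group lb3_sigma1_def lb3_sigma2_def
        lb3_s1_def lb3_s2_def gen_def)
  then show ?thesis unfolding SLB3_kernel_def by (intro normal_closure_normal) auto
qed

lemma group_SLB3: "group SLB3"
  unfolding SLB3_def by (rule normal.factorgroup_is_group[OF SLB3_kernel_normal])

lemma SLB3_proj_hom: "SLB3_proj \<in> hom LB3 SLB3"
  unfolding SLB3_def SLB3_proj_def by (rule normal.r_coset_hom_Mod[OF SLB3_kernel_normal])

definition GL :: "nat \<Rightarrow> complex mat monoid" where
  "GL d = units_of (ring_mat TYPE(complex) d ())"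

text \<open>Elements of \<^const>\<open>hom\<close> are unconstrained outside the carrier. Extensionality makes a
  representation a function on the carrier only, so that representations can be counted.\<close>

definition reps :: "'a monoid \<Rightarrow> nat \<Rightarrow> ('a \<Rightarrow> complex mat) set" where
  "reps G d = hom G (GL d) \<inter> extensional (carrier G)"

definition extends_to_LB3 ::
  "nat \<Rightarrow> (b3_gen word set \<Rightarrow> complex mat) \<Rightarrow> (lb3_gen word set \<Rightarrow> complex mat) \<Rightarrow> bool" where
  "extends_to_LB3 d \<rho> \<rho>' \<longleftrightarrow>
    \<rho>' \<in> reps LB3 d \<and> \<rho>' lb3_sigma1 = \<rho> b3_sigma1 \<and> \<rho>' lb3_sigma2 = \<rho> b3_sigma2"

definition standard_extension ::
  "nat \<Rightarrow> (b3_gen word set \<Rightarrow> complex mat) \<Rightarrow> (lb3_gen word set \<Rightarrow> complex mat) \<Rightarrow> bool" where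
  "standard_extension d \<rho> \<rho>' \<longleftrightarrow>
    extends_to_LB3 d \<rho> \<rho>' \<and>
    (\<exists>k. \<rho>' (lb3_s1 \<otimes>\<^bsub>LB3\<^esub> lb3_s2) = k \<cdot>\<^sub>m \<rho> (b3_sigma1 \<otimes>\<^bsub>B3\<^esub> b3_sigma2))"

definition factors_through_SLB3 :: "nat \<Rightarrow> (lb3_gen word set \<Rightarrow> complex mat) \<Rightarrow> bool" where
  "factors_through_SLB3 d \<rho>' \<longleftrightarrow>
    (\<exists>\<phi> \<in> reps SLB3 d. \<forall>x \<in> carrier LB3. \<rho>' x = \<phi> (SLB3_proj x))"

definition poly_at_mat :: "'a :: comm_ring_1 poly \<Rightarrow> 'a mat \<Rightarrow> 'a mat" where
  "poly_at_mat p A =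
    (\<Oplus>\<^bsub>ring_mat TYPE('a) (dim_row A) ()\<^esub> i \<in> {..degree p}. coeff p i \<cdot>\<^sub>m (A ^\<^sub>m i))"

definition is_minimal_poly :: "'a :: field poly \<Rightarrow> 'a mat \<Rightarrow> bool" where
  "is_minimal_poly p A \<longleftrightarrow>
    lead_coeff p = 1 \<and> poly_at_mat p A = 0\<^sub>m (dim_row A) (dim_row A) \<and>
    (\<forall>q. q \<noteq> 0 \<and> poly_at_mat q A = 0\<^sub>m (dim_row A) (dim_row A) \<longrightarrow> degree p \<le> degree q)"

end

(* Write S = rho'(s_1) for an extension rho' that factors through the symmetric loop braid group.
   The relations sigma_1 sigma_2 s_1 = s_2 sigma_1 sigma_2 and sigma_2 sigma_1 s_2 = s_1 sigma_2 sigma_1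
   make S commute with D = BAAB, and D A^2 = (AB)^3 in the braid group. As (s_1 s_2)^3 = 1, a standard
   extension forces (AB)^3 to be a scalar matrix, so S commutes with A^2. Because A and -A have no common
   eigenvalue, S then commutes with A. The minimal polynomial hypothesis makes every eigenspace of A
   one-dimensional, so the involution S acts on each of them by a sign, and these signs determine S.
   Finally S determines rho', since rho'(s_2) = (AB) S (AB)^{-1}. *)
theory Submission
  imports Defs
begin

text \<open>The matrix A need not be diagonalizable, so signs on eigenvectors do not visibly fix S
  on the generalized eigenspaces. Products of factors A - l take the place of a Jordan form. If S
  and T carry the same signs, then \<open>1 + S\<close> is annihilated by the product over the
  eigenvalues of sign +1 and \<open>1 - T\<close> by the product over those of sign -1. As
  everything commutes with A, both products annihilate (1 + S)(1 - T), and two products without a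
  common root annihilate only zero. Exchanging the roles gives (1 - S)(1 + T) = 0, and subtracting
  the two identities gives S = T. The same cancellation of linear factors leads from A^2 to A.
  One-dimensionality of an eigenspace is used in the form of a coordinate that is injective on it;
  it is found from the adjugate of x - A. That (AB)^3 is scalar is a property of rho alone. One
  standard extension suffices to establish it, and the extensions being counted may be
  nonstandard.\<close>

section \<open>Products of linear factors in a matrix, and their cancellation\<close>

lemma char_matrix_mult:
  assumes "(A :: 'a :: field mat) \<in> carrier_mat n n" "X \<in> carrier_mat n m"
  shows "char_matrix A l * X = A * X + (- l) \<cdot>\<^sub>m X"
  unfolding char_matrix_def using assms
  by (subst add_mult_distrib_mat[of _ n n]) (auto simp: mult_smult_assoc_mat[of _ n n])

lemma char_matrix_commute:
  assumes A: "(A :: 'a :: field mat) \<in> carrier_mat n n" and S: "S \<in> carrier_mat n n"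
    and AS: "A * S = S * A"
  shows "char_matrix A l * S = S * char_matrix A l"
proof -
  have "S * char_matrix A l = S * A + (- l) \<cdot>\<^sub>m S"
    unfolding char_matrix_def using A S
    by (subst mult_add_distrib_mat[of _ n n]) (auto simp: mult_smult_distrib[of _ n n])
  with char_matrix_mult[OF A S] AS show ?thesis by simp
qed

text \<open>This is p(A) for the monic polynomial p whose roots, with multiplicity, are the entries
  of the list; \<open>char_matrix A l\<close> is A - l. The factors are kept separate so that they
  can be cancelled one at a time.\<close>

fun linprod :: "'a :: field mat \<Rightarrow> 'a list \<Rightarrow> 'a mat" where
  "linprod A [] = 1\<^sub>m (dim_row A)"
| "linprod A (l # L) = char_matrix A l * linprod A L"

lemma linprod_carrier [simp]:
  assumes "A \<in> carrier_mat n n" shows "linprod A L \<in> carrier_mat n n"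
  using assms by (induction L) (auto simp: mult_carrier_mat[of _ n n])

lemma linprod_commute:
  assumes A: "A \<in> carrier_mat n n" and S: "S \<in> carrier_mat n n" and AS: "A * S = S * A"
  shows "linprod A L * S = S * linprod A L"
proof (induction L)
  case Nil
  then show ?case using A S by auto
next
  case (Cons l L)
  let ?c = "char_matrix A l" and ?M = "linprod A L"
  have c: "?c \<in> carrier_mat n n" "?M \<in> carrier_mat n n" using A by auto
  have "(?c * ?M) * S = ?c * (S * ?M)"
    using c S Cons.IH by (simp add: assoc_mult_mat[of _ n n _ n _ n])
  also have "\<dots> = (?c * S) * ?M" using c S by (simp add: assoc_mult_mat[of _ n n _ n _ n])
  also have "\<dots> = S * (?c * ?M)"
    using c S by (simp add: char_matrix_commute[OF A S AS] assoc_mult_mat[of _ n n _ n _ n])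
  finally show ?case by simp
qed

lemma linprod_commute_char_matrix:
  assumes A: "A \<in> carrier_mat n n"
  shows "linprod A L * char_matrix A l = char_matrix A l * linprod A L"
  by (rule linprod_commute[OF A]) (use A char_matrix_commute[OF A A] in auto)

text \<open>Factors are removed from the left: what remains to their right stays in
  \<open>C\<close>, where A - l has no kernel. The class \<open>C\<close> carries the extra
  information about X that excludes the eigenvalue l, since A - l itself is usually
  singular.\<close>

lemma linprod_cancel:
  assumes A: "A \<in> carrier_mat n n" and X: "X \<in> C" and C: "C \<subseteq> carrier_mat n n"
    and closed: "\<And>l Z. Z \<in> C \<Longrightarrow> char_matrix A l * Z \<in> C"
    and cancel: "\<And>l Z. l \<in> set L \<Longrightarrow> Z \<in> C \<Longrightarrow> char_matrix A l * Z = 0\<^sub>m n n \<Longrightarrow> Z = 0\<^sub>m n n"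
    and zero: "linprod A L * X = 0\<^sub>m n n"
  shows "X = 0\<^sub>m n n"
  using cancel zero
proof (induction L)
  case Nil
  then show ?case using A C X by auto
next
  case (Cons l L)
  have XC: "X \<in> carrier_mat n n" using X C by auto
  have inC: "linprod A M * X \<in> C" for M
    using A XC by (induction M) (auto simp: X assoc_mult_mat[of _ n n _ n _ n] intro: closed)
  have "char_matrix A l * (linprod A L * X) = 0\<^sub>m n n"
    using Cons.prems(2) A XC by (simp add: assoc_mult_mat[of _ n n _ n _ n])
  then have "linprod A L * X = 0\<^sub>m n n" using Cons.prems(1) inC by auto
  with Cons show ?case by auto
qed

text \<open>The factors commute, so a factor to be kept can be moved next to X. The induction then
  continues with (A - l) X in place of X, which is why X is generalized.\<close>

lemma linprod_cancel_filter:
  assumes A: "A \<in> carrier_mat n n" and X: "X \<in> C" and C: "C \<subseteq> carrier_mat n n"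
    and closed: "\<And>l Z. Z \<in> C \<Longrightarrow> char_matrix A l * Z \<in> C"
    and cancel: "\<And>l Z. l \<in> set L \<Longrightarrow> \<not> P l \<Longrightarrow> Z \<in> C \<Longrightarrow> char_matrix A l * Z = 0\<^sub>m n n \<Longrightarrow> Z = 0\<^sub>m n n"
    and zero: "linprod A L * X = 0\<^sub>m n n"
  shows "linprod A (filter P L) * X = 0\<^sub>m n n"
  using X cancel zero
proof (induction L arbitrary: X)
  case Nil
  then show ?case by auto
next
  case (Cons l L)
  have XC: "X \<in> carrier_mat n n" using Cons.prems C by auto
  let ?c = "char_matrix A l"
  have c: "?c \<in> carrier_mat n n" using A by auto
  have inC: "linprod A M * X \<in> C" for M
    using A XC
    by (induction M) (auto simp: Cons.prems(1) assoc_mult_mat[of _ n n _ n _ n] intro: closed)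
  have swap: "?c * (linprod A M * X) = linprod A M * (?c * X)" for M
    using A XC c linprod_commute_char_matrix[OF A, of M l]
    by (simp add: assoc_mult_mat[of _ n n _ n _ n, symmetric])
  have z: "?c * (linprod A L * X) = 0\<^sub>m n n"
    using Cons.prems(3) A XC by (simp add: assoc_mult_mat[of _ n n _ n _ n])
  show ?case
  proof (cases "P l")
    case True
    have "linprod A (filter P L) * (?c * X) = 0\<^sub>m n n"
      by (rule Cons.IH) (use Cons.prems closed z swap in auto)
    then show ?thesis using True swap A XC c by (simp add: assoc_mult_mat[of _ n n _ n _ n])
  next
    case False
    then have "linprod A L * X = 0\<^sub>m n n" using Cons.prems z inC by auto
    with Cons False show ?thesis by auto
  qed
qed

text \<open>The nonzero columns of Z are eigenvectors for l, on which a polynomial in A acts by its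
  value at l.\<close>

lemma linprod_eigen:
  assumes A: "A \<in> carrier_mat n n" and Z: "Z \<in> carrier_mat n n"
    and z: "char_matrix A l * Z = 0\<^sub>m n n"
  shows "linprod A M * Z = (\<Prod>m\<leftarrow>M. l - m) \<cdot>\<^sub>m Z"
proof (induction M)
  case Nil
  then show ?case using A Z by auto
next
  case (Cons m M)
  have *: "char_matrix A m * Z = (l - m) \<cdot>\<^sub>m Z"
  proof (rule eq_matI)
    fix i j assume "i < dim_row ((l - m) \<cdot>\<^sub>m Z)" "j < dim_col ((l - m) \<cdot>\<^sub>m Z)"
    then have ij: "i < n" "j < n" using Z by auto
    have "(A * Z + (- l) \<cdot>\<^sub>m Z) $$ (i, j) = 0" using z ij
      unfolding char_matrix_mult[OF A Z] by simp
    then have "(A * Z) $$ (i, j) = l * Z $$ (i, j)" using ij A Z by simp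
    moreover have "(A * Z + (- m) \<cdot>\<^sub>m Z) $$ (i, j) = (A * Z) $$ (i, j) - m * Z $$ (i, j)"
      using ij A Z by simp
    ultimately show "(char_matrix A m * Z) $$ (i, j) = ((l - m) \<cdot>\<^sub>m Z) $$ (i, j)"
      using ij Z unfolding char_matrix_mult[OF A Z] by (simp add: algebra_simps)
  qed (use A Z in \<open>auto simp: char_matrix_def\<close>)
  have "linprod A (m # M) * Z = char_matrix A m * (linprod A M * Z)"
    using A Z by (simp add: assoc_mult_mat[of _ n n _ n _ n])
  also have "\<dots> = (\<Prod>m\<leftarrow>M. l - m) \<cdot>\<^sub>m ((l - m) \<cdot>\<^sub>m Z)"
    unfolding Cons.IH using A Z by (simp add: mult_smult_distrib[of _ n n _ n] *)
  also have "\<dots> = (\<Prod>m\<leftarrow>m # M. l - m) \<cdot>\<^sub>m Z"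
    using Z by (intro eq_matI) (auto simp: ac_simps)
  finally show ?case .
qed

text \<open>This is coprimality without a Bezout identity. On the matrices annihilated by the
  product over \<open>M\<close>, a factor A - l with l in \<open>L\<close> has trivial kernel: on
  that kernel the product acts as the scalar prod (l - m), which is nonzero because the lists share
  no entry.\<close>

lemma linprod_disjoint:
  assumes A: "A \<in> carrier_mat n n" and X: "X \<in> carrier_mat n n"
    and "linprod A L * X = 0\<^sub>m n n" "linprod A M * X = 0\<^sub>m n n" "set L \<inter> set M = {}"
  shows "X = 0\<^sub>m n n"
proof (rule linprod_cancel[OF A, where L = L and C = "{Z \<in> carrier_mat n n. linprod A M * Z = 0\<^sub>m n n}"])
  fix l Z assume Z: "Z \<in> {Z \<in> carrier_mat n n. linprod A M * Z = 0\<^sub>m n n}"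
  have "linprod A M * (char_matrix A l * Z) = linprod A M * char_matrix A l * Z"
    using A Z by (intro assoc_mult_mat[of _ n n _ n _ n, symmetric]) auto
  also have "\<dots> = char_matrix A l * (linprod A M * Z)"
    unfolding linprod_commute_char_matrix[OF A] using A Z by (intro assoc_mult_mat[of _ n n _ n _ n]) auto
  finally have "linprod A M * (char_matrix A l * Z) = char_matrix A l * (linprod A M * Z)" .
  then show "char_matrix A l * Z \<in> {Z \<in> carrier_mat n n. linprod A M * Z = 0\<^sub>m n n}"
    using Z A by (simp add: right_mult_zero_mat[of _ n n n] mult_carrier_mat[of _ n n])
next
  fix l Z assume l: "l \<in> set L" and Z: "Z \<in> {Z \<in> carrier_mat n n. linprod A M * Z = 0\<^sub>m n n}"
    and z: "char_matrix A l * Z = 0\<^sub>m n n"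
  have eq: "(\<Prod>m\<leftarrow>M. l - m) \<cdot>\<^sub>m Z = 0\<^sub>m n n" using linprod_eigen[OF A _ z, of M] Z by auto
  have nz: "(\<Prod>m\<leftarrow>M. l - m) \<noteq> 0" using l assms(5) by (auto simp: prod_list_zero_iff)
  show "Z = 0\<^sub>m n n"
  proof (rule eq_matI)
    fix i j assume "i < dim_row (0\<^sub>m n n :: 'a mat)" "j < dim_col (0\<^sub>m n n :: 'a mat)"
    then show "Z $$ (i, j) = 0\<^sub>m n n $$ (i, j)"
      using arg_cong[OF eq, of "\<lambda>M. M $$ (i, j)"] Z nz by auto
  qed (use Z in auto)
qed (use assms in auto)

section \<open>Evaluation of polynomials at a matrix\<close>

lemma finsum_mat:
  assumes "finite F" "f \<in> F \<rightarrow> carrier_mat n n"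
  shows "finsum (ring_mat TYPE('a :: comm_ring_1) n ()) f F = mat n n (\<lambda>ij. \<Sum>i\<in>F. f i $$ ij)"
proof -
  interpret R: ring "ring_mat TYPE('a) n ()" by (rule ring_mat)
  show ?thesis
    using assms
  proof (induction F rule: finite_induct)
    case empty
    then show ?case by (auto simp: ring_mat_simps)
  next
    case (insert x F)
    have "finsum (ring_mat TYPE('a) n ()) f (insert x F) =
        f x + finsum (ring_mat TYPE('a) n ()) f F"
      using insert by (subst R.finsum_insert) (auto simp: ring_mat_simps)
    with insert show ?case by (auto intro!: eq_matI)
  qed
qed

text \<open>The free bound \<open>N\<close> lets polynomials of different degrees be compared over
  one summation range.\<close>

lemma poly_at_mat_eq:
  assumes A: "A \<in> carrier_mat n n" and N: "degree p \<le> N"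
  shows "poly_at_mat p A = mat n n (\<lambda>ij. \<Sum>i\<le>N. coeff p i * (A ^\<^sub>m i) $$ ij)"
proof -
  have d: "dim_row A = n" using A by auto
  have "poly_at_mat p A = mat n n (\<lambda>ij. \<Sum>i\<le>degree p. (coeff p i \<cdot>\<^sub>m (A ^\<^sub>m i)) $$ ij)"
    unfolding poly_at_mat_def d using A by (intro finsum_mat) auto
  also have "\<dots> = mat n n (\<lambda>ij. \<Sum>i\<le>N. coeff p i * (A ^\<^sub>m i) $$ ij)"
  proof (rule cong_mat)
    fix r c assume rc: "r < n" "c < n"
    have "(\<Sum>i\<le>degree p. (coeff p i \<cdot>\<^sub>m (A ^\<^sub>m i)) $$ (r, c)) =
        (\<Sum>i\<le>degree p. coeff p i * (A ^\<^sub>m i) $$ (r, c))"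
      using A rc by (intro sum.cong HOL.refl) (simp add: pow_carrier_mat)
    also have "\<dots> = (\<Sum>i\<le>N. coeff p i * (A ^\<^sub>m i) $$ (r, c))"
      using N by (intro sum.mono_neutral_left) (auto simp: coeff_eq_0)
    finally show "(\<Sum>i\<le>degree p. (coeff p i \<cdot>\<^sub>m (A ^\<^sub>m i)) $$ (r, c)) =
        (\<Sum>i\<le>N. coeff p i * (A ^\<^sub>m i) $$ (r, c))" .
  qed auto
  finally show ?thesis .
qed

lemma poly_at_mat_carrier [simp]:
  "A \<in> carrier_mat n n \<Longrightarrow> poly_at_mat p A \<in> carrier_mat n n"
  by (simp add: poly_at_mat_eq[OF _ order.refl])

lemma pow_mat_Suc_left:
  "A \<in> carrier_mat n n \<Longrightarrow> A ^\<^sub>m Suc k = A * A ^\<^sub>m k"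
proof (induction k)
  case (Suc k)
  have "A ^\<^sub>m Suc (Suc k) = (A * A ^\<^sub>m k) * A" using Suc by simp
  also have "\<dots> = A * A ^\<^sub>m Suc k" using Suc.prems by (simp add: assoc_mult_mat[of _ n n _ n _ n])
  finally show ?case .
qed auto

text \<open>Coefficient i + 1 of (x - l) p is p_i - l p_(i+1). The sum for the product thus splits
  into a shifted copy, which is A p(A), and -l times the original one.\<close>

lemma poly_at_mat_linear_factor:
  fixes A :: "'a :: field mat"
  assumes A: "A \<in> carrier_mat n n"
  shows "poly_at_mat ([:- l, 1:] * p) A = char_matrix A l * poly_at_mat p A"
proof (rule eq_matI)
  fix r c assume "r < dim_row (char_matrix A l * poly_at_mat p A)"
    "c < dim_col (char_matrix A l * poly_at_mat p A)"
  then have rc: "r < n" "c < n"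
    using A poly_at_mat_carrier[OF A, of p] by (auto simp: char_matrix_def)
  let ?N = "degree p" and ?q = "[:- l, 1:] * p"
  let ?P = "poly_at_mat p A"
  have P: "?P \<in> carrier_mat n n" using A by simp
  have dq: "degree ?q \<le> Suc ?N" using degree_mult_le[of "[:- l, 1:]" p] by simp
  have cq: "coeff ?q 0 = - l * coeff p 0" "coeff ?q (Suc i) = coeff p i - l * coeff p (Suc i)" for i
    by simp_all
  have "(A * ?P) $$ (r, c) = (\<Sum>k<n. A $$ (r, k) * (\<Sum>i\<le>?N. coeff p i * (A ^\<^sub>m i) $$ (k, c)))"
    using A P rc by (simp add: scalar_prod_def poly_at_mat_eq[OF A order.refl, of p] atLeast0LessThan)
  also have "\<dots> = (\<Sum>i\<le>?N. coeff p i * (\<Sum>k<n. A $$ (r, k) * (A ^\<^sub>m i) $$ (k, c)))"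
    unfolding sum_distrib_left by (subst sum.swap) (simp add: ac_simps)
  also have "\<dots> = (\<Sum>i\<le>?N. coeff p i * (A ^\<^sub>m Suc i) $$ (r, c))"
  proof (intro sum.cong HOL.refl arg_cong2[where f = "(*)"])
    fix i
    have "A ^\<^sub>m i \<in> carrier_mat n n" using A by (rule pow_carrier_mat)
    then show "(\<Sum>k<n. A $$ (r, k) * (A ^\<^sub>m i) $$ (k, c)) = (A ^\<^sub>m Suc i) $$ (r, c)"
      unfolding pow_mat_Suc_left[OF A]
      using A rc by (simp add: scalar_prod_def atLeast0LessThan)
  qed
  finally have AP: "(A * ?P) $$ (r, c) = (\<Sum>i\<le>?N. coeff p i * (A ^\<^sub>m Suc i) $$ (r, c))" .
  have "?P $$ (r, c) = (\<Sum>i\<le>Suc ?N. coeff p i * (A ^\<^sub>m i) $$ (r, c))"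
    using rc by (simp add: poly_at_mat_eq[OF A, of p "Suc ?N"])
  also have "\<dots> = coeff p 0 * (A ^\<^sub>m 0) $$ (r, c) +
      (\<Sum>i\<le>?N. coeff p (Suc i) * (A ^\<^sub>m Suc i) $$ (r, c))"
    by (rule sum.atMost_Suc_shift)
  finally have P': "?P $$ (r, c) = \<dots>" .
  have "poly_at_mat ?q A $$ (r, c) = (\<Sum>i\<le>Suc ?N. coeff ?q i * (A ^\<^sub>m i) $$ (r, c))"
    unfolding poly_at_mat_eq[OF A dq] using rc by simp
  also have "\<dots> = coeff ?q 0 * (A ^\<^sub>m 0) $$ (r, c) +
      (\<Sum>i\<le>?N. coeff ?q (Suc i) * (A ^\<^sub>m Suc i) $$ (r, c))"
    by (rule sum.atMost_Suc_shift)
  also have "\<dots> = (A * ?P) $$ (r, c) - l * ?P $$ (r, c)"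
    unfolding AP P' cq
    by (simp add: algebra_simps sum_distrib_left sum_subtractf del: pow_mat.simps)
  also have "\<dots> = (char_matrix A l * ?P) $$ (r, c)"
    unfolding char_matrix_mult[OF A P] using rc A carrier_matD[OF P] by simp
  finally show "poly_at_mat ?q A $$ (r, c) = (char_matrix A l * ?P) $$ (r, c)" .
qed (use A carrier_matD[OF poly_at_mat_carrier[OF A]] in \<open>simp_all add: char_matrix_def del: mult_pCons_left\<close>)

lemma poly_at_mat_linear_factors:
  fixes A :: "'a :: field mat"
  assumes A: "A \<in> carrier_mat n n"
  shows "poly_at_mat (\<Prod>a\<leftarrow>L. [:- a, 1:]) A = linprod A L"
proof (induction L)
  case Nil
  show ?case using A by (auto simp: poly_at_mat_eq[OF A, of 1 0] intro!: eq_matI)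
next
  case (Cons l L)
  then show ?case by (simp only: list.map prod_list.Cons poly_at_mat_linear_factor[OF A] linprod.simps)
qed

text \<open>Comparing coefficients in \<open>(x - A) M(x) = q(x)\<close> makes \<open>q(A)\<close> a telescoping sum.\<close>
lemma poly_at_mat_zero_if_char_poly_matrix_mult:
  fixes A :: "'a :: field mat"
  assumes A: "A \<in> carrier_mat n n" and M: "M \<in> carrier_mat n n"
    and eq: "char_poly_matrix A * M = q \<cdot>\<^sub>m 1\<^sub>m n"
  shows "poly_at_mat q A = 0\<^sub>m n n"
proof -
  \<comment> \<open>M is read as a polynomial in x with matrix coefficients: \<open>C i\<close> is
    the coefficient of x^i.\<close>
  define C where "C i = map_mat (\<lambda>p. coeff p i) M" for i
  have C: "C i \<in> carrier_mat n n" for i using M by (simp add: C_def)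
  have step: "coeff q i * (if r = c then 1 else 0) =
      (if i = 0 then 0 else C (i - 1) $$ (r, c)) - (A * C i) $$ (r, c)"
    if rc: "r < n" "c < n" for i r c
  proof -
    have "(q \<cdot>\<^sub>m 1\<^sub>m n) $$ (r, c) = (char_poly_matrix A * M) $$ (r, c)" using eq by simp
    also have "\<dots> = (\<Sum>k<n. ((if r = k then [:0, 1:] else 0) + [:- A $$ (r, k):]) * M $$ (k, c))"
      using A M rc
      by (auto simp: scalar_prod_def char_poly_matrix_def atLeast0LessThan intro!: sum.cong)
    also have "\<dots> = (\<Sum>k<n. if r = k then [:0, 1:] * M $$ (k, c) else 0) +
        (\<Sum>k<n. [:- A $$ (r, k):] * M $$ (k, c))"
      by (subst sum.distrib[symmetric], intro sum.cong) (auto simp: algebra_simps)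
    also have "\<dots> = [:0, 1:] * M $$ (r, c) + (\<Sum>k<n. [:- A $$ (r, k):] * M $$ (k, c))"
      using rc by simp
    finally have "coeff (q * (if r = c then 1 else 0)) i =
        coeff ([:0, 1:] * M $$ (r, c) + (\<Sum>k<n. [:- A $$ (r, k):] * M $$ (k, c))) i"
      using rc by (auto simp: if_distribR)
    moreover have "coeff ([:0, 1:] * M $$ (r, c)) i = (if i = 0 then 0 else C (i - 1) $$ (r, c))"
      using rc M by (cases i) (auto simp: C_def)
    moreover have "coeff (\<Sum>k<n. [:- A $$ (r, k):] * M $$ (k, c)) i = - (A * C i) $$ (r, c)"
      using A M rc
      by (simp add: C_def coeff_sum scalar_prod_def atLeast0LessThan sum_negf)
    ultimately show ?thesis by (auto split: if_splits)
  qed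
  \<comment> \<open>Coefficient i of q times the identity is C_(i-1) - A C_i. After multiplication
    by A^i neighbouring terms cancel, and only the last one survives.\<close>
  have tele: "(\<Sum>i\<le>N. coeff q i * (A ^\<^sub>m i) $$ (r, c)) = - (A ^\<^sub>m Suc N * C N) $$ (r, c)"
    if rc: "r < n" "c < n" for N r c
  proof (induction N)
    case 0
    show ?case using step[OF rc, of 0] A C[of 0] rc by (simp split: if_splits)
  next
    case (Suc N)
    let ?P = "A ^\<^sub>m Suc N"
    have P: "?P \<in> carrier_mat n n" using A by (rule pow_carrier_mat)
    have eqm: "coeff q (Suc N) \<cdot>\<^sub>m 1\<^sub>m n = C N - A * C (Suc N)"
      using A C[of N] C[of "Suc N"] step[of _ _ "Suc N"] by (intro eq_matI) auto
    have "coeff q (Suc N) \<cdot>\<^sub>m ?P = ?P * (coeff q (Suc N) \<cdot>\<^sub>m 1\<^sub>m n)"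
      using P by (simp add: mult_smult_distrib[of _ n n _ n] right_mult_one_mat[of _ n n] del: pow_mat.simps)
    also have "\<dots> = ?P * C N - ?P * (A * C (Suc N))"
      unfolding eqm using P A C by (intro mult_minus_distrib_mat) auto
    also have "?P * (A * C (Suc N)) = A ^\<^sub>m Suc (Suc N) * C (Suc N)"
      using P A C[of "Suc N"] by (simp add: assoc_mult_mat[of _ n n _ n _ n])
    finally have "(coeff q (Suc N) \<cdot>\<^sub>m ?P) $$ (r, c) =
        (?P * C N - A ^\<^sub>m Suc (Suc N) * C (Suc N)) $$ (r, c)" by simp
    moreover have "(coeff q (Suc N) \<cdot>\<^sub>m ?P) $$ (r, c) = coeff q (Suc N) * ?P $$ (r, c)"
      using carrier_matD[OF P] rc by (intro index_smult_mat(1)) simp_all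
    moreover have "(?P * C N - A ^\<^sub>m Suc (Suc N) * C (Suc N)) $$ (r, c) =
        (?P * C N) $$ (r, c) - (A ^\<^sub>m Suc (Suc N) * C (Suc N)) $$ (r, c)"
      using carrier_matD[OF mult_carrier_mat[OF pow_carrier_mat[OF A] C]] rc
      by (intro index_minus_mat(1)) simp_all
    ultimately have "coeff q (Suc N) * ?P $$ (r, c) =
        (?P * C N) $$ (r, c) - (A ^\<^sub>m Suc (Suc N) * C (Suc N)) $$ (r, c)"
      by (simp only:)
    with Suc.IH show ?case by (simp del: pow_mat.simps)
  qed
  \<comment> \<open>The added 1 makes \<open>N\<close> exceed the degree of every entry of M, so
    \<open>C N\<close> vanishes and the surviving term with it. Including the degree of q covers all
    of q and keeps the set nonempty when n = 0.\<close>
  define N where "N = Max (insert (degree q) (degree ` (\<lambda>ij. M $$ ij) ` ({..<n} \<times> {..<n}))) + 1"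
  have qN: "degree q \<le> N" unfolding N_def by (rule trans_le_add1) (rule Max_ge, auto)
  have CN: "C N = 0\<^sub>m n n"
  proof (rule eq_matI)
    fix r c assume "r < dim_row (0\<^sub>m n n :: 'a mat)" "c < dim_col (0\<^sub>m n n :: 'a mat)"
    then have rc: "r < n" "c < n" by auto
    have "degree (M $$ (r, c)) < N" unfolding N_def less_Suc_eq_le Suc_eq_plus1[symmetric]
      by (rule Max_ge) (use rc in auto)
    then show "C N $$ (r, c) = 0\<^sub>m n n $$ (r, c)" using rc M by (simp add: C_def coeff_eq_0)
  qed (use C[of N] in auto)
  show ?thesis unfolding poly_at_mat_eq[OF A qN]
  proof (rule eq_matI, goal_cases)
    case (1 r c)
    then have rc: "r < n" "c < n" by auto
    have "A ^\<^sub>m Suc N \<in> carrier_mat n n" using A by (rule pow_carrier_mat)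
    then have "A ^\<^sub>m Suc N * C N = 0\<^sub>m n n" unfolding CN by (rule right_mult_zero_mat)
    with tele[OF rc, of N] rc show ?case by (simp del: pow_mat.simps)
  qed auto
qed

section \<open>The adjugate of x - A and one-dimensional eigenspaces\<close>

text \<open>Expanding along the replaced column leaves a single cofactor, and deleting that column
  hides the replacement. In this form an entry of the adjugate is a full determinant, which vanishes
  as soon as a kernel vector is exhibited.\<close>

lemma adj_mat_entry:
  assumes A: "A \<in> carrier_mat n n" and ij: "i < n" "j < n"
  shows "adj_mat A $$ (i, j) = det (replace_col A (unit_vec n j) i)"
proof -
  have "det (replace_col A (unit_vec n j) i) =
      (\<Sum>k<n. replace_col A (unit_vec n j) i $$ (k, i) * cofactor (replace_col A (unit_vec n j) i) k i)"
    by (rule laplace_expansion_column[OF _ ij(1)]) (use A in \<open>auto simp: replace_col_def\<close>)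
  also have "\<dots> = (\<Sum>k<n. if k = j then cofactor A k i else 0)"
  proof (rule sum.cong[OF HOL.refl])
    fix k assume "k \<in> {..<n}"
    moreover have "mat_delete (replace_col A (unit_vec n j) i) k i = mat_delete A k i"
      using A by (auto simp: mat_delete_def replace_col_def intro!: eq_matI)
    ultimately show "replace_col A (unit_vec n j) i $$ (k, i) *
        cofactor (replace_col A (unit_vec n j) i) k i = (if k = j then cofactor A k i else 0)"
      using A ij by (simp add: replace_col_def cofactor_def)
  qed
  also have "\<dots> = adj_mat A $$ (i, j)" using ij A by (simp add: adj_mat_def)
  finally show ?thesis by simp
qed

text \<open>If every coordinate vanishes on some eigenvector for \<open>l\<close>, then \<open>l\<close> is a zero of all
  \<open>(n-1)\<close>-minors of \<open>x - A\<close>. Dividing its adjugate by \<open>x - l\<close> shows that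
  \<open>char_poly A / (x - l)\<close> annihilates \<open>A\<close>.\<close>
lemma eigenvector_coordinate:
  fixes A :: "'a :: field mat"
  assumes A: "A \<in> carrier_mat n n" and min: "is_minimal_poly (char_poly A) A"
    and l: "poly (char_poly A) l = 0"
  obtains i where "i < n" and
    "\<And>u. u \<in> carrier_vec n \<Longrightarrow> char_matrix A l *\<^sub>v u = 0\<^sub>v n \<Longrightarrow> u $ i = 0 \<Longrightarrow> u = 0\<^sub>v n"
proof (rule ccontr)
  note coordinate = that
  assume neg: "\<not> thesis"
  let ?N = "char_poly_matrix A"
  have N: "?N \<in> carrier_mat n n" using A by simp
  have root: "[:- l, 1:] dvd adj_mat ?N $$ (i, j)" if ij: "i < n" "j < n" for i j
  proof -
    obtain u where u: "u \<in> carrier_vec n" "char_matrix A l *\<^sub>v u = 0\<^sub>v n" "u $ i = 0" "u \<noteq> 0\<^sub>v n"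
      using neg coordinate ij(1) by blast
    \<comment> \<open>The matrix \<open>- char_matrix A l\<close> is x - A at x = l, so det R is the
      value at l of the (i, j) entry of the adjugate. As u has coordinate 0 at i, the replaced
      column does not affect the product with u, and R u = (l - A) u = 0.\<close>
    define R where "R = replace_col (- char_matrix A l) (unit_vec n j) i"
    have R: "R \<in> carrier_mat n n" using A by (simp add: R_def replace_col_def char_matrix_def)
    have "R *\<^sub>v u = 0\<^sub>v n"
    proof (rule eq_vecI)
      fix r assume "r < dim_vec (0\<^sub>v n :: 'a vec)"
      then have r: "r < n" by simp
      have "(R *\<^sub>v u) $ r = (\<Sum>k<n. - (char_matrix A l $$ (r, k) * u $ k))"
        using R r A u(1,3)
        by (auto simp: scalar_prod_def atLeast0LessThan R_def replace_col_def char_matrix_def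
            algebra_simps intro!: sum.cong)
      also have "\<dots> = - (char_matrix A l *\<^sub>v u) $ r"
        using r A u(1)
        by (auto simp: scalar_prod_def atLeast0LessThan sum_negf char_matrix_def intro!: sum.cong)
      finally show "(R *\<^sub>v u) $ r = 0\<^sub>v n $ r" using u(2) r by simp
    qed (use R in auto)
    then have "det R = 0" using det_0_iff_vec_prod_zero[OF R] u by blast
    moreover have "poly (adj_mat ?N $$ (i, j)) l = det R"
      unfolding adj_mat_entry[OF N ij]
      by (rule poly_det_cong[OF R])
        (use A N ij in \<open>auto simp: R_def replace_col_def char_poly_matrix_def char_matrix_def\<close>)
    ultimately show ?thesis by (simp add: poly_eq_0_iff_dvd)
  qed
  obtain q where q: "char_poly A = [:- l, 1:] * q" using l by (auto simp: poly_eq_0_iff_dvd)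
  define M where "M = map_mat (\<lambda>p. p div [:- l, 1:]) (adj_mat ?N)"
  have aN: "adj_mat ?N \<in> carrier_mat n n" by (rule adj_mat[OF N])
  then have M: "M \<in> carrier_mat n n" by (simp add: M_def)
  have "adj_mat ?N = [:- l, 1:] \<cdot>\<^sub>m M"
    using aN root by (intro eq_matI) (auto simp: M_def dvd_mult_div_cancel simp del: mult_pCons_left)
  then have eqM: "[:- l, 1:] \<cdot>\<^sub>m (?N * M) = [:- l, 1:] \<cdot>\<^sub>m (q \<cdot>\<^sub>m 1\<^sub>m n)"
    using adj_mat(2)[OF N] q N M
    by (simp add: char_poly_def[symmetric] mult_smult_distrib[of _ n n _ n])
       (auto intro!: eq_matI)
  have cancel: "[:- l, 1:] * (?N * M) $$ (i, j) = [:- l, 1:] * (q \<cdot>\<^sub>m 1\<^sub>m n) $$ (i, j)"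
    if "i < n" "j < n" for i j
  proof -
    have "([:- l, 1:] \<cdot>\<^sub>m (?N * M)) $$ (i, j) = [:- l, 1:] * (?N * M) $$ (i, j)"
      "([:- l, 1:] \<cdot>\<^sub>m (q \<cdot>\<^sub>m 1\<^sub>m n)) $$ (i, j) = [:- l, 1:] * (q \<cdot>\<^sub>m 1\<^sub>m n) $$ (i, j)"
      using that carrier_matD(1)[OF N] carrier_matD(2)[OF M] by (intro index_smult_mat(1); simp)+
    with eqM show ?thesis by (simp only:)
  qed
  have "?N * M = q \<cdot>\<^sub>m 1\<^sub>m n"
  proof (rule eq_matI)
    fix i j assume "i < dim_row (q \<cdot>\<^sub>m 1\<^sub>m n)" "j < dim_col (q \<cdot>\<^sub>m 1\<^sub>m n)"
    then show "(?N * M) $$ (i, j) = (q \<cdot>\<^sub>m 1\<^sub>m n) $$ (i, j)"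
      using mult_left_cancel[of "[:- l, 1:]"] cancel[of i j] by (metis index_one_mat(2,3) index_smult_mat(2,3) pCons_eq_0_iff one_neq_zero)
  qed (use N M in auto)
  then have "poly_at_mat q A = 0\<^sub>m n n"
    by (rule poly_at_mat_zero_if_char_poly_matrix_mult[OF A M])
  moreover have "char_poly A \<noteq> 0" using min by (auto simp: is_minimal_poly_def)
  then have "q \<noteq> 0" using q by auto
  moreover have "degree (char_poly A) = Suc (degree q)"
    unfolding q by (subst degree_mult_eq) (use \<open>q \<noteq> 0\<close> in auto)
  ultimately show False using min A by (auto simp: is_minimal_poly_def)
qed

section \<open>From commuting with A^2 to commuting with A\<close>

lemma mult_eq_zero_det_nonzero:
  assumes Z: "Z \<in> carrier_mat n n" and C: "(C :: 'a :: field mat) \<in> carrier_mat n n"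
    and eq: "Z * C = 0\<^sub>m n n" and det: "det C \<noteq> 0"
  shows "Z = 0\<^sub>m n n"
proof -
  have "det C \<cdot>\<^sub>m Z = Z * (det C \<cdot>\<^sub>m 1\<^sub>m n)"
    using Z by (simp add: mult_smult_distrib[of _ n n _ n] right_mult_one_mat[of _ n n])
  also have "\<dots> = Z * C * adj_mat C"
    unfolding adj_mat(2)[OF C, symmetric] using Z C adj_mat(1)[OF C]
    by (simp add: assoc_mult_mat[of _ n n _ n _ n])
  also have "\<dots> = 0\<^sub>m n n" unfolding eq using adj_mat(1)[OF C] by auto
  finally have *: "det C \<cdot>\<^sub>m Z = 0\<^sub>m n n" .
  show ?thesis
  proof (rule eq_matI)
    fix i j assume "i < dim_row (0\<^sub>m n n :: 'a mat)" "j < dim_col (0\<^sub>m n n :: 'a mat)"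
    then show "Z $$ (i, j) = 0\<^sub>m n n $$ (i, j)"
      using arg_cong[OF *, of "\<lambda>M. M $$ (i, j)"] Z det by auto
  qed (use Z in auto)
qed

text \<open>\<open>X = A S - S A\<close> satisfies \<open>A X = - X A\<close>, and \<open>A\<close> and \<open>- A\<close> share no eigenvalue.\<close>
lemma commute_if_commute_square:
  fixes A :: "'a :: field mat"
  assumes A: "A \<in> carrier_mat n n" and S: "S \<in> carrier_mat n n"
    and L: "linprod A L = 0\<^sub>m n n" and neg: "\<And>l. l \<in> set L \<Longrightarrow> \<not> eigenvalue A (- l)"
    and sq: "A * A * S = S * (A * A)"
  shows "A * S = S * A"
proof -
  let ?C = "{Z \<in> carrier_mat n n. A * Z = - (Z * A)}"
  define X where "X = A * S - S * A"
  have X: "X \<in> carrier_mat n n"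
    unfolding X_def using A S by (intro minus_carrier_mat mult_carrier_mat[of _ n n])
  have AX: "A * X = - (X * A)"
  proof -
    have c: "A * S \<in> carrier_mat n n" "S * A \<in> carrier_mat n n"
      using A S by (auto simp: mult_carrier_mat[of _ n n])
    have "A * X = A * (A * S) - A * (S * A)"
      unfolding X_def using A c by (intro mult_minus_distrib_mat)
    moreover have "X * A = A * S * A - S * A * A"
      unfolding X_def using A c by (intro minus_mult_distrib_mat)
    moreover have "A * (A * S) = S * A * A"
      using assoc_mult_mat[OF A A S] assoc_mult_mat[OF S A A] sq by metis
    moreover have "A * S * A = A * (S * A)" by (rule assoc_mult_mat[OF A S A])
    moreover have "S * A * A - A * (S * A) = - (A * (S * A) - S * A * A)"
      using carrier_matD[OF mult_carrier_mat[OF A c(2)]] carrier_matD[OF mult_carrier_mat[OF c(2) A]]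
      by (intro eq_matI) (simp_all del: index_mult_mat(1))
    ultimately show ?thesis by (simp only:)
  qed
  have "X = 0\<^sub>m n n"
  proof (rule linprod_cancel[OF A, where C = ?C and L = L])
    fix l Z assume Z: "Z \<in> ?C"
    let ?c = "char_matrix A l"
    have c: "?c \<in> carrier_mat n n" using A by simp
    have "A * (?c * Z) = A * ?c * Z"
      using A c Z by (intro assoc_mult_mat[of _ n n _ n _ n, symmetric]) auto
    also have "\<dots> = ?c * (A * Z)"
      unfolding char_matrix_commute[OF A A HOL.refl, symmetric]
      using A c Z by (intro assoc_mult_mat[of _ n n _ n _ n]) auto
    also have "\<dots> = - (?c * (Z * A))"
    proof -
      have "A * Z = - (Z * A)" using Z by simp
      moreover have "?c * - (Z * A) = - (?c * (Z * A))"
        using c Z by (intro uminus_mult_right_mat) auto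
      ultimately show ?thesis by (simp only:)
    qed
    also have "?c * (Z * A) = ?c * Z * A"
      using A c Z by (intro assoc_mult_mat[of _ n n _ n _ n, symmetric]) auto
    finally show "?c * Z \<in> ?C" using c Z by (simp add: mult_carrier_mat[of _ n n])
  next
    fix l Z assume l: "l \<in> set L" and Z: "Z \<in> ?C" and z: "char_matrix A l * Z = 0\<^sub>m n n"
    have Zc: "Z \<in> carrier_mat n n" using Z by simp
    let ?c = "char_matrix A (- l)"
    \<comment> \<open>From A Z = l Z and A Z = - Z A it follows that Z (A + l) = 0. Here A + l is
      nonsingular, because -l is not an eigenvalue, and cancels on the right.\<close>
    have "Z * ?c = Z * A + l \<cdot>\<^sub>m Z"
      unfolding char_matrix_def using A Zc
      by (subst mult_add_distrib_mat[of _ n n])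
        (auto simp: mult_smult_distrib[of _ n n] right_mult_one_mat[of _ n n])
    also have "\<dots> = 0\<^sub>m n n"
    proof (rule eq_matI)
      fix i j assume "i < dim_row (0\<^sub>m n n :: 'a mat)" "j < dim_col (0\<^sub>m n n :: 'a mat)"
      then have ij: "i < n" "j < n" by auto
      have "(A * Z + (- l) \<cdot>\<^sub>m Z) $$ (i, j) = 0"
        using z ij unfolding char_matrix_mult[OF A Zc] by simp
      then have "(A * Z) $$ (i, j) = l * Z $$ (i, j)" using ij A Zc by simp
      moreover have "(A * Z) $$ (i, j) = - (Z * A) $$ (i, j)"
        using Z carrier_matD[OF mult_carrier_mat[OF Zc A]] ij by simp
      ultimately show "(Z * A + l \<cdot>\<^sub>m Z) $$ (i, j) = 0\<^sub>m n n $$ (i, j)"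
        using ij A Zc by (simp add: neg_eq_iff_add_eq_0)
    qed (use A Zc in auto)
    finally show "Z = 0\<^sub>m n n"
      using neg[OF l] A by (intro mult_eq_zero_det_nonzero[OF Zc, of ?c]) (simp_all add: eigenvalue_det[OF A])
  qed (use A X AX L in auto)
  show ?thesis
  proof (rule eq_matI)
    fix i j assume "i < dim_row (S * A)" "j < dim_col (S * A)"
    then show "(A * S) $$ (i, j) = (S * A) $$ (i, j)"
      using arg_cong[OF \<open>X = 0\<^sub>m n n\<close>, of "\<lambda>M. M $$ (i, j)"] A S by (simp add: X_def)
  qed (use A S in auto)
qed

section \<open>Involutions that commute with A\<close>

text \<open>Both a = v - S v and b = w + S w lie in the eigenspace of A for l, with S a = -a and S b
  = b. The eigenspace being at most one-dimensional, a and b cannot both be nonzero, and a is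
  nonzero because S moves v.\<close>

lemma involution_sign_on_eigenspace:
  fixes A :: "'a :: field_char_0 mat"
  assumes A: "A \<in> carrier_mat n n" and min: "is_minimal_poly (char_poly A) A"
    and l: "poly (char_poly A) l = 0"
    and S: "S \<in> carrier_mat n n" and SS: "S * S = 1\<^sub>m n" and AS: "A * S = S * A"
    and v: "v \<in> carrier_vec n" "char_matrix A l *\<^sub>v v = 0\<^sub>v n" "S *\<^sub>v v \<noteq> v"
    and w: "w \<in> carrier_vec n" "char_matrix A l *\<^sub>v w = 0\<^sub>v n"
  shows "S *\<^sub>v w = - w"
proof (rule ccontr)
  assume neg: "S *\<^sub>v w \<noteq> - w"
  obtain i where i: "i < n" and
    ker: "\<And>u. u \<in> carrier_vec n \<Longrightarrow> char_matrix A l *\<^sub>v u = 0\<^sub>v n \<Longrightarrow> u $ i = 0 \<Longrightarrow> u = 0\<^sub>v n"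
    using eigenvector_coordinate[OF A min l] by metis
  let ?c = "char_matrix A l"
  have c: "?c \<in> carrier_mat n n" using A by simp
  have Sker: "?c *\<^sub>v (S *\<^sub>v u) = 0\<^sub>v n" if u: "u \<in> carrier_vec n" "?c *\<^sub>v u = 0\<^sub>v n" for u
  proof -
    have "?c *\<^sub>v (S *\<^sub>v u) = (?c * S) *\<^sub>v u"
      by (rule assoc_mult_mat_vec[OF c S u(1), symmetric])
    also have "\<dots> = S *\<^sub>v (?c *\<^sub>v u)"
      unfolding char_matrix_commute[OF A S AS] by (rule assoc_mult_mat_vec[OF S c u(1)])
    finally show ?thesis using u(2) S by auto
  qed
  have SSv: "S *\<^sub>v (S *\<^sub>v u) = u" if "u \<in> carrier_vec n" for u
    using assoc_mult_mat_vec[OF S S that] that SS by simp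
  have Sc: "S *\<^sub>v u \<in> carrier_vec n" if "u \<in> carrier_vec n" for u using S that by simp
  define a b where "a = v - S *\<^sub>v v" and "b = w + S *\<^sub>v w"
  have ab: "a \<in> carrier_vec n" "b \<in> carrier_vec n"
    using v w Sc by (auto simp: a_def b_def)
  have a0: "a \<noteq> 0\<^sub>v n"
  proof
    assume "a = 0\<^sub>v n"
    then have "v $ j = (S *\<^sub>v v) $ j" if "j < n" for j
    proof -
      have "a $ j = v $ j - (S *\<^sub>v v) $ j"
        unfolding a_def using carrier_vecD[OF Sc[OF v(1)]] that by (intro index_minus_vec(1)) simp
      then show ?thesis using \<open>a = 0\<^sub>v n\<close> that by simp
    qed
    then have "S *\<^sub>v v = v" using carrier_vecD[OF Sc[OF v(1)]] v(1) by (intro eq_vecI) auto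
    with v show False by simp
  qed
  have b0: "b \<noteq> 0\<^sub>v n"
  proof
    assume "b = 0\<^sub>v n"
    then have "w $ j + (S *\<^sub>v w) $ j = 0" if "j < n" for j
    proof -
      have "b $ j = w $ j + (S *\<^sub>v w) $ j"
        unfolding b_def using carrier_vecD[OF Sc[OF w(1)]] that by (intro index_add_vec(1)) simp
      then show ?thesis using \<open>b = 0\<^sub>v n\<close> that by simp
    qed
    then have "S *\<^sub>v w = - w"
      using carrier_vecD[OF Sc[OF w(1)]] w(1) by (intro eq_vecI) (auto simp: add_eq_0_iff)
    with neg show False by simp
  qed
  have ca: "?c *\<^sub>v a = 0\<^sub>v n"
    unfolding a_def using c v w Sc Sker by (subst mult_minus_distrib_mat_vec[OF c]) auto
  have cb: "?c *\<^sub>v b = 0\<^sub>v n"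
    unfolding b_def using c v w Sc Sker by (subst mult_add_distrib_mat_vec[OF c]) auto
  have Sa: "S *\<^sub>v a = - a"
    unfolding a_def using S v Sc SSv by (subst mult_minus_distrib_mat_vec[OF S]) auto
  have Sb: "S *\<^sub>v b = b"
    unfolding b_def using S w Sc SSv comm_add_vec[OF w(1) Sc[OF w(1)]]
    by (subst mult_add_distrib_mat_vec[OF S]) auto
  \<comment> \<open>This combination has coordinate 0 at i, hence is zero. Applying S reverses the
    sign of the a term only, and adding the two equations gives 2 a_i b = 0, where a_i is nonzero by
    the choice of i.\<close>
  let ?u = "b $ i \<cdot>\<^sub>v a - a $ i \<cdot>\<^sub>v b"
  have u0: "?u = 0\<^sub>v n"
  proof (rule ker)
    show "?c *\<^sub>v ?u = 0\<^sub>v n" using ab ca cb c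
      by (subst mult_minus_distrib_mat_vec[OF c]) (auto simp: mult_mat_vec[OF c])
  qed (use ab i in auto)
  then have "S *\<^sub>v ?u = 0\<^sub>v n" using S by auto
  moreover have "S *\<^sub>v ?u = b $ i \<cdot>\<^sub>v (- a) - a $ i \<cdot>\<^sub>v b"
    using ab S by (subst mult_minus_distrib_mat_vec[OF S]) (auto simp: mult_mat_vec[OF S] Sa Sb)
  ultimately have su: "b $ i \<cdot>\<^sub>v (- a) - a $ i \<cdot>\<^sub>v b = 0\<^sub>v n" by simp
  have ai: "a $ i \<noteq> 0" using ker[OF ab(1) ca] a0 by auto
  have "b $ j = 0" if j: "j < n" for j
  proof -
    have "b $ i * a $ j - a $ i * b $ j = 0" "- (b $ i * a $ j) - a $ i * b $ j = 0"
      using arg_cong[OF u0, of "\<lambda>x. x $ j"] arg_cong[OF su, of "\<lambda>x. x $ j"] j ab by auto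
    then have "2 * (a $ i * b $ j) = 0" by (simp add: algebra_simps)
    with ai show ?thesis by simp
  qed
  then have "b = 0\<^sub>v n" using ab by (intro eq_vecI) auto
  with b0 show False by simp
qed

text \<open>Since S (1 + S) = 1 + S, cancellation runs over the matrices Z with S Z = Z. If A Z = l
  Z for an l outside \<open>P\<close>, then S both fixes and negates the columns of Z, so Z = 0. In
  effect the +1 space of S lies in the sum of the generalized eigenspaces for the l in
  \<open>P\<close>.\<close>

lemma linprod_filter_involution:
  fixes A :: "'a :: field_char_0 mat"
  assumes A: "A \<in> carrier_mat n n" and L: "linprod A L = 0\<^sub>m n n"
    and S: "S \<in> carrier_mat n n" and SS: "S * S = 1\<^sub>m n" and AS: "A * S = S * A"
    and sign: "\<And>l v. l \<in> set L \<Longrightarrow> \<not> P l \<Longrightarrow> v \<in> carrier_vec n \<Longrightarrow>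
      char_matrix A l *\<^sub>v v = 0\<^sub>v n \<Longrightarrow> S *\<^sub>v v = - v"
  shows "linprod A (filter P L) * (1\<^sub>m n + S) = 0\<^sub>m n n"
proof (rule linprod_cancel_filter[OF A, where C = "{Z \<in> carrier_mat n n. S * Z = Z}"])
  have "S * (1\<^sub>m n + S) = S + 1\<^sub>m n"
    using S SS by (subst mult_add_distrib_mat[OF S]) auto
  then show "1\<^sub>m n + S \<in> {Z \<in> carrier_mat n n. S * Z = Z}" using S comm_add_mat[OF S one_carrier_mat] by simp
next
  fix l Z assume Z: "Z \<in> {Z \<in> carrier_mat n n. S * Z = Z}"
  let ?c = "char_matrix A l"
  have c: "?c \<in> carrier_mat n n" using A by simp
  have "S * (?c * Z) = S * ?c * Z"
    using S c Z by (intro assoc_mult_mat[of _ n n _ n _ n, symmetric]) auto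
  also have "\<dots> = ?c * (S * Z)"
    unfolding char_matrix_commute[OF A S AS, symmetric]
    using S c Z by (intro assoc_mult_mat[of _ n n _ n _ n]) auto
  finally show "?c * Z \<in> {Z \<in> carrier_mat n n. S * Z = Z}"
    using c Z by (simp add: mult_carrier_mat[of _ n n])
next
  fix l Z assume l: "l \<in> set L" "\<not> P l" and "Z \<in> {Z \<in> carrier_mat n n. S * Z = Z}"
    and z: "char_matrix A l * Z = 0\<^sub>m n n"
  then have Z: "Z \<in> carrier_mat n n" and SZ: "S * Z = Z" by auto
  have c: "char_matrix A l \<in> carrier_mat n n" using A by simp
  show "Z = 0\<^sub>m n n"
  proof (rule eq_matI)
    fix i j assume "i < dim_row (0\<^sub>m n n :: 'a mat)" "j < dim_col (0\<^sub>m n n :: 'a mat)"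
    then have ij: "i < n" "j < n" by auto
    have "char_matrix A l *\<^sub>v col Z j = 0\<^sub>v n"
      using col_mult2[OF c Z ij(2)] z ij by simp
    then have "S *\<^sub>v col Z j = - col Z j" using sign[OF l] Z by auto
    moreover have "S *\<^sub>v col Z j = col Z j" using col_mult2[OF S Z ij(2)] SZ by simp
    ultimately have "col Z j $ i = (- col Z j) $ i" by simp
    then show "Z $$ (i, j) = 0\<^sub>m n n $$ (i, j)" using ij Z by simp
  qed (use Z in auto)
qed (use assms in auto)

text \<open>The second product moves past U to reach V, so both products annihilate U V.
  Complementary filters leave lists with no common root.\<close>

lemma linprod_filter_mult_zero:
  assumes A: "A \<in> carrier_mat n n" and U: "U \<in> carrier_mat n n" and V: "V \<in> carrier_mat n n"
    and AU: "A * U = U * A"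
    and PU: "linprod A (filter P L) * U = 0\<^sub>m n n"
    and QV: "linprod A (filter (\<lambda>l. \<not> P l) L) * V = 0\<^sub>m n n"
  shows "U * V = 0\<^sub>m n n"
proof (rule linprod_disjoint[OF A])
  let ?P = "linprod A (filter P L)" and ?Q = "linprod A (filter (\<lambda>l. \<not> P l) L)"
  have PQ: "?P \<in> carrier_mat n n" "?Q \<in> carrier_mat n n" using A by auto
  show "U * V \<in> carrier_mat n n" using U V by simp
  have "?P * (U * V) = ?P * U * V" using PQ U V by (simp add: assoc_mult_mat[of _ n n _ n _ n])
  then show "?P * (U * V) = 0\<^sub>m n n" unfolding PU using V by simp
  have "?Q * (U * V) = ?Q * U * V" using PQ U V by (simp add: assoc_mult_mat[of _ n n _ n _ n])
  also have "\<dots> = U * (?Q * V)"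
    unfolding linprod_commute[OF A U AU] using PQ U V by (simp add: assoc_mult_mat[of _ n n _ n _ n])
  finally show "?Q * (U * V) = 0\<^sub>m n n" unfolding QV using U by simp
qed auto

lemma involution_eq_if_same_signs:
  fixes A :: "'a :: field_char_0 mat"
  assumes A: "A \<in> carrier_mat n n" and L: "linprod A L = 0\<^sub>m n n"
    and S: "S \<in> carrier_mat n n" "S * S = 1\<^sub>m n" "A * S = S * A"
    and T: "T \<in> carrier_mat n n" "T * T = 1\<^sub>m n" "A * T = T * A"
    and pos: "\<And>l v. l \<in> set L \<Longrightarrow> P l \<Longrightarrow> v \<in> carrier_vec n \<Longrightarrow>
      char_matrix A l *\<^sub>v v = 0\<^sub>v n \<Longrightarrow> S *\<^sub>v v = v \<and> T *\<^sub>v v = v"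
    and neg: "\<And>l v. l \<in> set L \<Longrightarrow> \<not> P l \<Longrightarrow> v \<in> carrier_vec n \<Longrightarrow>
      char_matrix A l *\<^sub>v v = 0\<^sub>v n \<Longrightarrow> S *\<^sub>v v = - v \<and> T *\<^sub>v v = - v"
  shows "S = T"
proof -
  have minus: "- R \<in> carrier_mat n n" "- R * - R = 1\<^sub>m n" "A * - R = - R * A"
    if "R \<in> carrier_mat n n" "R * R = 1\<^sub>m n" "A * R = R * A" for R :: "'a mat"
    using that A by auto
  have minus_vec: "- R *\<^sub>v v = - v" if "R \<in> carrier_mat n n" "v \<in> carrier_vec n" "R *\<^sub>v v = v" for R :: "'a mat" and v
    using that by (metis carrier_matD(2) carrier_vecD uminus_mult_mat_vec)
  have comm: "A * (1\<^sub>m n + R) = (1\<^sub>m n + R) * A"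
    if "R \<in> carrier_mat n n" "A * R = R * A" for R
    unfolding mult_add_distrib_mat[OF A one_carrier_mat that(1)]
      add_mult_distrib_mat[OF one_carrier_mat that(1) A] that(2)
    using A by simp
  have plus: "linprod A (filter P L) * (1\<^sub>m n + S) = 0\<^sub>m n n"
    using neg by (intro linprod_filter_involution[OF A L S]) simp
  have plus': "linprod A (filter P L) * (1\<^sub>m n + T) = 0\<^sub>m n n"
    using neg by (intro linprod_filter_involution[OF A L T]) simp
  \<comment> \<open>For \<open>- S\<close> the signs are reversed: the eigenvectors to be negated
    are those for the l in \<open>P\<close>, so the complementary filter remains.\<close>
  have minus_l: "linprod A (filter (\<lambda>l. \<not> P l) L) * (1\<^sub>m n + - S) = 0\<^sub>m n n"
    using pos by (intro linprod_filter_involution[OF A L minus[OF S]] minus_vec[OF S(1)]) simp_all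
  have minus_l': "linprod A (filter (\<lambda>l. \<not> P l) L) * (1\<^sub>m n + - T) = 0\<^sub>m n n"
    using pos by (intro linprod_filter_involution[OF A L minus[OF T]] minus_vec[OF T(1)]) simp_all
  have ST: "(1\<^sub>m n + S) * (1\<^sub>m n + - T) = 0\<^sub>m n n"
    by (rule linprod_filter_mult_zero[OF A _ _ comm[OF S(1,3)] plus minus_l']) (use S T in simp_all)
  have TS: "(1\<^sub>m n + - S) * (1\<^sub>m n + T) = 0\<^sub>m n n"
    by (rule linprod_filter_mult_zero[OF A _ _ comm[OF minus(1,3)[OF S]] minus_l])
      (use S(1) T(1) plus' in simp_all)
  have ST': "(1\<^sub>m n + S) * (1\<^sub>m n + - T) = (1\<^sub>m n + - T) + (S + - (S * T))"
    using S T by (subst add_mult_distrib_mat[of _ n n], auto)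
      (subst mult_add_distrib_mat[of _ n n], auto)
  have TS': "(1\<^sub>m n + - S) * (1\<^sub>m n + T) = (1\<^sub>m n + T) + (- S + - (S * T))"
    using S T by (subst add_mult_distrib_mat[of _ n n], auto)
      (subst mult_add_distrib_mat[of _ n n], auto)
  show ?thesis
  proof (rule eq_matI)
    fix i j assume "i < dim_row T" "j < dim_col T"
    then have ij: "i < n" "j < n" using T by auto
    let ?d = "if i = j then 1 else 0 :: 'a"
    have eqs: "?d - T $$ (i, j) + (S $$ (i, j) - (S * T) $$ (i, j)) = 0"
      "?d + T $$ (i, j) + (- S $$ (i, j) - (S * T) $$ (i, j)) = 0"
      using arg_cong[OF ST[unfolded ST'], of "\<lambda>M. M $$ (i, j)"]
        arg_cong[OF TS[unfolded TS'], of "\<lambda>M. M $$ (i, j)"] ij S T by simp_all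
    have "2 * (s - t) = (e - t + (s - w)) - (e + t + (- s - w))" for s t e w :: 'a
      by (simp add: algebra_simps)
    from this[of "S $$ (i, j)" "T $$ (i, j)" ?d "(S * T) $$ (i, j)"]
    have "2 * (S $$ (i, j) - T $$ (i, j)) = 0" unfolding eqs by simp
    then show "S $$ (i, j) = T $$ (i, j)" by simp
  qed (use S T in auto)
qed

lemma finite_involutions_commuting_square:
  fixes A :: "complex mat"
  assumes A: "A \<in> carrier_mat n n" and min: "is_minimal_poly (char_poly A) A"
    and neg: "\<And>x y. eigenvalue A x \<Longrightarrow> eigenvalue A y \<Longrightarrow> x \<noteq> - y"
  shows "finite {S \<in> carrier_mat n n. S * S = 1\<^sub>m n \<and> A * A * S = S * (A * A)}" (is "finite ?F")
proof -
  obtain L where chi: "char_poly A = (\<Prod>a\<leftarrow>L. [:- a, 1:])"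
    using char_poly_factorized[OF A] by blast
  \<comment> \<open>That the characteristic polynomial annihilates A is part of its being the
    minimal polynomial.\<close>
  have L: "linprod A L = 0\<^sub>m n n"
    using min A unfolding is_minimal_poly_def chi poly_at_mat_linear_factors[OF A] by auto
  have root: "poly (char_poly A) l = 0" if "l \<in> set L" for l
    using that unfolding chi by (induction L) auto
  have ev: "eigenvalue A l" if "l \<in> set L" for l
    using root[OF that] by (simp add: eigenvalue_root_char_poly[OF A])
  \<comment> \<open>The set of eigenvalues on whose eigenspace S is the identity. On the eigenspace
    of every other entry of \<open>L\<close> the sign is -1, so this subset of the spectrum encodes
    all signs of S, and there are finitely many subsets.\<close>
  define plus where
    "plus S = {l \<in> set L. \<forall>v \<in> carrier_vec n. char_matrix A l *\<^sub>v v = 0\<^sub>v n \<longrightarrow> S *\<^sub>v v = v}" for S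
  have comm: "A * S = S * A" if "S \<in> ?F" for S
  proof (rule commute_if_commute_square[OF A _ L])
    show "\<not> eigenvalue A (- l)" if "l \<in> set L" for l
      using neg[OF _ ev[OF that], of "- l"] by auto
  qed (use that in auto)
  have minus: "S *\<^sub>v v = - v"
    if "S \<in> ?F" "l \<in> set L" "l \<notin> plus S" "v \<in> carrier_vec n" "char_matrix A l *\<^sub>v v = 0\<^sub>v n" for S l v
  proof -
    obtain w where "w \<in> carrier_vec n" "char_matrix A l *\<^sub>v w = 0\<^sub>v n" "S *\<^sub>v w \<noteq> w"
      using \<open>l \<in> set L\<close> \<open>l \<notin> plus S\<close> unfolding plus_def by blast
    then show ?thesis
      using that(1)
      by (intro involution_sign_on_eigenspace[OF A min root[OF that(2)] _ _ comm[OF that(1)] _ _ _ that(4,5)])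
        simp_all
  qed
  have "inj_on plus ?F"
  proof (rule inj_onI)
    fix S T assume S: "S \<in> ?F" and T: "T \<in> ?F" and eq: "plus S = plus T"
    show "S = T"
    proof (rule involution_eq_if_same_signs[OF A L, where P = "\<lambda>l. l \<in> plus S"])
      show "S *\<^sub>v v = v \<and> T *\<^sub>v v = v"
        if "l \<in> plus S" "v \<in> carrier_vec n" "char_matrix A l *\<^sub>v v = 0\<^sub>v n" for l v
      proof -
        have "l \<in> plus S \<inter> plus T" using that eq by simp
        then show ?thesis using that unfolding plus_def by blast
      qed
      show "S *\<^sub>v v = - v \<and> T *\<^sub>v v = - v"
        if "l \<in> set L" "l \<notin> plus S" "v \<in> carrier_vec n" "char_matrix A l *\<^sub>v v = 0\<^sub>v n" for l v
        using minus[OF S that] minus[OF T that(1) _ that(3,4)] that(2) eq by simp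
    qed (use S T comm[OF S] comm[OF T] in blast)+
  qed
  moreover have "finite (plus ` ?F)"
    by (rule finite_subset[of _ "Pow (set L)"]) (auto simp: plus_def)
  ultimately show ?thesis by (rule finite_imageD[rotated])
qed

section \<open>Invertible matrices and homomorphisms out of presented groups\<close>

lemma GL_simps:
  "x \<otimes>\<^bsub>GL d\<^esub> y = x * y" "\<one>\<^bsub>GL d\<^esub> = 1\<^sub>m d"
  by (simp_all add: GL_def units_of_def ring_mat_simps)

lemma group_GL: "group (GL d)"
proof -
  interpret ring "ring_mat TYPE(complex) d ()" by (rule ring_mat)
  show ?thesis unfolding GL_def by (rule units_group)
qed

lemma carrier_GL: "x \<in> carrier (GL d) \<Longrightarrow> x \<in> carrier_mat d d"
  by (auto simp: GL_def units_of_def Units_def ring_mat_simps)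

lemma eigenvalue_GL_nonzero:
  assumes "A \<in> carrier (GL d)" shows "\<not> eigenvalue A 0"
proof
  assume "eigenvalue A 0"
  then obtain v where v: "v \<in> carrier_vec (dim_row A)" "v \<noteq> 0\<^sub>v (dim_row A)" "A *\<^sub>v v = 0 \<cdot>\<^sub>v v"
    by (auto simp: eigenvalue_def eigenvector_def)
  have A: "A \<in> carrier_mat d d" using assms by (rule carrier_GL)
  obtain Y where Y: "Y \<in> carrier_mat d d" "Y * A = 1\<^sub>m d"
    using assms by (auto simp: GL_def units_of_def Units_def ring_mat_simps)
  have vd: "v \<in> carrier_vec d" "v \<noteq> 0\<^sub>v d" using v A by auto
  have "v = (Y * A) *\<^sub>v v" using Y vd by simp
  also have "\<dots> = Y *\<^sub>v (A *\<^sub>v v)" by (rule assoc_mult_mat_vec[OF Y(1) A vd(1)])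
  also have "A *\<^sub>v v = 0\<^sub>v d" using v(3) vd by (auto intro!: eq_vecI)
  also have "Y *\<^sub>v 0\<^sub>v d = 0\<^sub>v d" using Y by auto
  finally show False using vd by simp
qed

lemma gen_closed: "gen R g \<in> carrier (presented_group R)"
  by (simp add: gen_def carrier_presented_group)

text \<open>Every class is a product of classes of letters, and the cancellation rule makes the
  class of a formal inverse the true inverse of the generator, whose image is therefore prescribed
  as well.\<close>

lemma hom_presented_group_eqI:
  assumes f: "f \<in> hom (presented_group R) H" and h: "h \<in> hom (presented_group R) H"
    and H: "group H" and gens: "\<And>g. f (gen R g) = h (gen R g)"
    and x: "x \<in> carrier (presented_group R)"
  shows "f x = h x"
proof -
  let ?G = "presented_group R"
  interpret f: group_hom ?G H f
    using f H group_presented_group by (simp add: group_hom_def group_hom_axioms_def)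
  interpret h: group_hom ?G H h
    using h H group_presented_group by (simp add: group_hom_def group_hom_axioms_def)
  have one: "word_class R [] = \<one>\<^bsub>?G\<^esub>" by (simp add: presented_group_def)
  have "f (word_class R w) = h (word_class R w)" for w
  proof (induction w)
    case Nil
    then show ?case by (simp add: one)
  next
    case (Cons a w)
    obtain g b where a: "a = (g, b)" by (cases a)
    have letter: "f (word_class R [(g, b)]) = h (word_class R [(g, b)])"
    proof (cases b)
      case True
      then show ?thesis using gens[of g] by (simp add: gen_def)
    next
      case False
      have "word_class R [(g, False)] \<otimes>\<^bsub>?G\<^esub> gen R g = \<one>\<^bsub>?G\<^esub>"
        unfolding gen_def mult_word_class one[symmetric] word_class_eq_iff
        using word_cong.cancel[of g False R] by simp
      then have "inv\<^bsub>?G\<^esub> gen R g = word_class R [(g, False)]"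
        by (rule f.G.inv_equality) (simp_all add: gen_closed, simp add: carrier_presented_group)
      then show ?thesis using False gens[of g] f.hom_inv[OF gen_closed] h.hom_inv[OF gen_closed]
        by metis
    qed
    have split: "word_class R (a # w) = word_class R [(g, b)] \<otimes>\<^bsub>?G\<^esub> word_class R w"
      by (simp add: a mult_word_class)
    have "word_class R [(g, b)] \<in> carrier ?G" "word_class R w \<in> carrier ?G"
      by (simp_all add: carrier_presented_group)
    then show ?case unfolding split using letter Cons.IH by (simp only: f.hom_mult h.hom_mult)
  qed
  with x show ?thesis by (auto simp: carrier_presented_group)
qed

lemma lb3_gens_closed:
  "lb3_sigma1 \<in> carrier LB3" "lb3_sigma2 \<in> carrier LB3" "lb3_s1 \<in> carrier LB3" "lb3_s2 \<in> carrier LB3"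
  by (simp_all add: LB3_def lb3_sigma1_def lb3_sigma2_def lb3_s1_def lb3_s2_def gen_closed)

lemma presented_group_rel:
  "(u, v) \<in> R \<Longrightarrow> word_class R u = word_class R v"
  by (simp add: word_class_eq_iff word_cong.rel)

lemma lb3_relations:
  "lb3_sigma1 \<otimes>\<^bsub>LB3\<^esub> lb3_sigma2 \<otimes>\<^bsub>LB3\<^esub> lb3_sigma1 = lb3_sigma2 \<otimes>\<^bsub>LB3\<^esub> lb3_sigma1 \<otimes>\<^bsub>LB3\<^esub> lb3_sigma2"
  "lb3_s1 \<otimes>\<^bsub>LB3\<^esub> lb3_s2 \<otimes>\<^bsub>LB3\<^esub> lb3_s1 = lb3_s2 \<otimes>\<^bsub>LB3\<^esub> lb3_s1 \<otimes>\<^bsub>LB3\<^esub> lb3_s2"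
  "lb3_s1 \<otimes>\<^bsub>LB3\<^esub> lb3_s1 = \<one>\<^bsub>LB3\<^esub>"
  "lb3_s2 \<otimes>\<^bsub>LB3\<^esub> lb3_s2 = \<one>\<^bsub>LB3\<^esub>"
  "lb3_sigma1 \<otimes>\<^bsub>LB3\<^esub> lb3_sigma2 \<otimes>\<^bsub>LB3\<^esub> lb3_s1 = lb3_s2 \<otimes>\<^bsub>LB3\<^esub> lb3_sigma1 \<otimes>\<^bsub>LB3\<^esub> lb3_sigma2"
proof -
  have one: "\<one>\<^bsub>presented_group LB3_rels\<^esub> = word_class LB3_rels []"
    by (simp add: presented_group_def)
  note [simp] = LB3_def lb3_sigma1_def lb3_sigma2_def lb3_s1_def lb3_s2_def gen_def mult_word_class one
  show "lb3_sigma1 \<otimes>\<^bsub>LB3\<^esub> lb3_sigma2 \<otimes>\<^bsub>LB3\<^esub> lb3_sigma1 = lb3_sigma2 \<otimes>\<^bsub>LB3\<^esub> lb3_sigma1 \<otimes>\<^bsub>LB3\<^esub> lb3_sigma2"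
    "lb3_s1 \<otimes>\<^bsub>LB3\<^esub> lb3_s2 \<otimes>\<^bsub>LB3\<^esub> lb3_s1 = lb3_s2 \<otimes>\<^bsub>LB3\<^esub> lb3_s1 \<otimes>\<^bsub>LB3\<^esub> lb3_s2"
    "lb3_s1 \<otimes>\<^bsub>LB3\<^esub> lb3_s1 = \<one>\<^bsub>LB3\<^esub>"
    "lb3_s2 \<otimes>\<^bsub>LB3\<^esub> lb3_s2 = \<one>\<^bsub>LB3\<^esub>"
    "lb3_sigma1 \<otimes>\<^bsub>LB3\<^esub> lb3_sigma2 \<otimes>\<^bsub>LB3\<^esub> lb3_s1 = lb3_s2 \<otimes>\<^bsub>LB3\<^esub> lb3_sigma1 \<otimes>\<^bsub>LB3\<^esub> lb3_sigma2"
    by (simp_all, (rule presented_group_rel, simp add: LB3_rels_def pos_def)+)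
qed

text \<open>The kernel contains x y^-1 for the two sides x and y of the added relation, and x = (x
  y^-1) y then lies in the coset of y.\<close>

lemma SLB3_proj_relation:
  "SLB3_proj (lb3_sigma2 \<otimes>\<^bsub>LB3\<^esub> lb3_sigma1 \<otimes>\<^bsub>LB3\<^esub> lb3_s2) =
   SLB3_proj (lb3_s1 \<otimes>\<^bsub>LB3\<^esub> lb3_sigma2 \<otimes>\<^bsub>LB3\<^esub> lb3_sigma1)"
proof -
  interpret group LB3 by (rule group_LB3)
  let ?x = "lb3_sigma2 \<otimes>\<^bsub>LB3\<^esub> lb3_sigma1 \<otimes>\<^bsub>LB3\<^esub> lb3_s2"
  let ?y = "lb3_s1 \<otimes>\<^bsub>LB3\<^esub> lb3_sigma2 \<otimes>\<^bsub>LB3\<^esub> lb3_sigma1"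
  have xy: "?x \<in> carrier LB3" "?y \<in> carrier LB3" by (simp_all add: lb3_gens_closed)
  then have "?x \<otimes>\<^bsub>LB3\<^esub> inv\<^bsub>LB3\<^esub> ?y \<in> SLB3_kernel"
    unfolding SLB3_kernel_def normal_closure_def by blast
  moreover have "?x \<otimes>\<^bsub>LB3\<^esub> inv\<^bsub>LB3\<^esub> ?y \<otimes>\<^bsub>LB3\<^esub> ?y = ?x"
    by (rule inv_solve_right[THEN iffD1, symmetric]) (use xy in simp_all)
  ultimately have "?x \<in> SLB3_kernel #>\<^bsub>LB3\<^esub> ?y" unfolding r_coset_def by force
  then have "SLB3_kernel #>\<^bsub>LB3\<^esub> ?y = SLB3_kernel #>\<^bsub>LB3\<^esub> ?x"
    by (rule repr_independence[OF _ xy(2) normal_imp_subgroup[OF SLB3_kernel_normal]])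
  then show ?thesis by (simp add: SLB3_proj_def)
qed

section \<open>The full twist and its consequences for s_1\<close>

text \<open>Up to a scalar E is the inverse of D, and an inverse commutes with whatever D commutes
  with. In the application E = A^2 and c = k^3.\<close>

lemma commute_scaled_inverse:
  fixes D :: "'a :: field mat"
  assumes D: "D \<in> carrier_mat n n" and E: "E \<in> carrier_mat n n" and S: "S \<in> carrier_mat n n"
    and DS: "D * S = S * D" and DE: "c \<cdot>\<^sub>m (D * E) = 1\<^sub>m n"
  shows "E * S = S * E"
proof (cases "c = 0")
  \<comment> \<open>With c = 0 the assumption reads 0 = 1, which happens only for n = 0, where all
    matrices coincide.\<close>
  case True
  have zero: "X = 0\<^sub>m n n" if X: "X \<in> carrier_mat n n" for X :: "'a mat"
  proof -
    have "1\<^sub>m n = (0\<^sub>m n n :: 'a mat)" unfolding DE[symmetric] True using D E by (auto intro!: eq_matI)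
    moreover have "X = 1\<^sub>m n * X" using X by simp
    ultimately show ?thesis using X by simp
  qed
  show ?thesis using zero[OF mult_carrier_mat[OF E S]] zero[OF mult_carrier_mat[OF S E]] by simp
next
  case False
  define U where "U = c \<cdot>\<^sub>m E"
  have U: "U \<in> carrier_mat n n" using E by (simp add: U_def)
  have DU: "D * U = 1\<^sub>m n" using DE mult_smult_distrib[OF D E] by (simp add: U_def)
  have UD: "U * D = 1\<^sub>m n" by (rule mat_mult_left_right_inverse[OF D U DU])
  note assoc = assoc_mult_mat[of _ n n _ n _ n]
  have "U * S = U * S * (D * U)" unfolding DU using U S by simp
  also have "\<dots> = U * (S * D) * U" using U S D by (simp add: assoc)
  also have "\<dots> = (U * D) * (S * U)" unfolding DS[symmetric] using U S D by (simp add: assoc)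
  also have "\<dots> = S * U" unfolding UD using S U by (intro left_mult_one_mat mult_carrier_mat)
  finally have "c \<cdot>\<^sub>m (E * S) = c \<cdot>\<^sub>m (S * E)"
    unfolding U_def mult_smult_assoc_mat[OF E S] mult_smult_distrib[OF S E] .
  then show ?thesis
  proof (intro eq_matI)
    fix i j assume eq: "c \<cdot>\<^sub>m (E * S) = c \<cdot>\<^sub>m (S * E)" and "i < dim_row (S * E)" "j < dim_col (S * E)"
    then have ij: "i < dim_row (E * S)" "j < dim_col (E * S)" "i < dim_row (S * E)" "j < dim_col (S * E)"
      using E S by auto
    have "c * (E * S) $$ (i, j) = c * (S * E) $$ (i, j)"
      using arg_cong[OF eq, of "\<lambda>M. M $$ (i, j)"] ij
      by (simp only: index_smult_mat(1))
    with False show "(E * S) $$ (i, j) = (S * E) $$ (i, j)" by simp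
  qed (use E S in auto)
qed

text \<open>The left side is the full twist, the square of the half twist ABA = BAB. Rewriting half
  twists until A^2 splits off on the right leaves BAAB.\<close>

lemma braid_identity:
  fixes A :: "'a :: semiring_1 mat"
  assumes A: "A \<in> carrier_mat n n" and B: "B \<in> carrier_mat n n"
    and braid: "A * B * A = B * A * B"
  shows "(A * B) * (A * B) * (A * B) = (B * A * (A * B)) * (A * A)"
proof -
  note assoc = assoc_mult_mat[of _ n n _ n _ n]
  have "(A * B) * (A * B) * (A * B) = (A * B * A) * (B * A * B)" using A B by (simp add: assoc)
  also have "\<dots> = (B * A * B) * (A * B * A)" using braid by simp
  also have "\<dots> = (B * A) * (B * A * B) * A" using A B by (simp add: assoc)
  also have "\<dots> = (B * A) * (A * B * A) * A" using braid by simp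
  also have "\<dots> = (B * A * (A * B)) * (A * A)" using A B by (simp add: assoc)
  finally show ?thesis .
qed

lemma factors_through_SLB3_relation:
  assumes "factors_through_SLB3 d \<rho>"
  shows "\<rho> (lb3_sigma2 \<otimes>\<^bsub>LB3\<^esub> lb3_sigma1 \<otimes>\<^bsub>LB3\<^esub> lb3_s2) =
    \<rho> (lb3_s1 \<otimes>\<^bsub>LB3\<^esub> lb3_sigma2 \<otimes>\<^bsub>LB3\<^esub> lb3_sigma1)"
proof -
  interpret group LB3 by (rule group_LB3)
  show ?thesis
    using assms SLB3_proj_relation by (auto simp: factors_through_SLB3_def lb3_gens_closed)
qed

lemma reps_LB3_eqI:
  assumes "\<rho> \<in> reps LB3 d" "\<rho>' \<in> reps LB3 d"
    and "\<rho> lb3_sigma1 = \<rho>' lb3_sigma1" "\<rho> lb3_sigma2 = \<rho>' lb3_sigma2"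
    and "\<rho> lb3_s1 = \<rho>' lb3_s1" "\<rho> lb3_s2 = \<rho>' lb3_s2"
  shows "\<rho> = \<rho>'"
proof (rule extensionalityI[of _ "carrier LB3"])
  have homs: "\<rho> \<in> hom (presented_group LB3_rels) (GL d)" "\<rho>' \<in> hom (presented_group LB3_rels) (GL d)"
    using assms(1,2) by (simp_all add: reps_def LB3_def)
  fix x assume x: "x \<in> carrier LB3"
  have gens: "\<rho> (gen LB3_rels g) = \<rho>' (gen LB3_rels g)" for g
    using assms(3-6) by (cases g) (simp_all add: lb3_sigma1_def lb3_sigma2_def lb3_s1_def lb3_s2_def)
  show "\<rho> x = \<rho>' x"
    using hom_presented_group_eqI[OF homs group_GL gens x[unfolded LB3_def]] .
qed (use assms in \<open>auto simp: reps_def\<close>)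

theorem theorem2p16:
  fixes d :: nat and \<rho> :: "b3_gen word set \<Rightarrow> complex mat" and A B :: "complex mat"
  assumes "\<rho> \<in> reps B3 d"
    and "\<rho> b3_sigma1 = A" and "\<rho> b3_sigma2 = B"
    and "is_minimal_poly (char_poly A) A"
    and "is_minimal_poly (char_poly B) B"
    and "\<And>x y. eigenvalue A x \<Longrightarrow> eigenvalue A y \<Longrightarrow> x \<noteq> y \<Longrightarrow> x \<noteq> - y"
    and "\<exists>\<rho>'. standard_extension d \<rho> \<rho>'"
  shows "finite {\<rho>'. extends_to_LB3 d \<rho> \<rho>' \<and> factors_through_SLB3 d \<rho>'}"

proof -
  interpret LB3: group LB3 by (rule group_LB3)
  interpret GL: group "GL d" by (rule group_GL)
  let ?F = "{\<rho>'. extends_to_LB3 d \<rho> \<rho>' \<and> factors_through_SLB3 d \<rho>'}"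
  have hom: "r \<in> hom LB3 (GL d)" if "extends_to_LB3 d \<rho> r" for r
    using that by (simp add: extends_to_LB3_def reps_def)
  have mult: "r (x \<otimes>\<^bsub>LB3\<^esub> y) = r x * r y"
    if "extends_to_LB3 d \<rho> r" "x \<in> carrier LB3" "y \<in> carrier LB3" for r x y
    using hom_mult[OF hom[OF that(1)] that(2,3)] by (simp add: GL_simps)
  have GL: "r x \<in> carrier (GL d)" if "extends_to_LB3 d \<rho> r" "x \<in> carrier LB3" for r x
    using hom[OF that(1)] that(2) by (rule hom_in_carrier)
  have one: "r \<one>\<^bsub>LB3\<^esub> = 1\<^sub>m d" if "extends_to_LB3 d \<rho> r" for r
    using hom_one[OF hom[OF that] group_LB3 group_GL] by (simp add: GL_simps)
  note closed [simp] = lb3_gens_closed LB3.m_closed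
  note assoc = assoc_mult_mat[of _ d d _ d _ d]
  have sigma: "r lb3_sigma1 = A" "r lb3_sigma2 = B" if "extends_to_LB3 d \<rho> r" for r
    using that assms(2,3) by (simp_all add: extends_to_LB3_def)
  obtain \<rho>s k where ext: "extends_to_LB3 d \<rho> \<rho>s"
    and k: "\<rho>s (lb3_s1 \<otimes>\<^bsub>LB3\<^esub> lb3_s2) = k \<cdot>\<^sub>m \<rho> (b3_sigma1 \<otimes>\<^bsub>B3\<^esub> b3_sigma2)"
    using assms(7) by (auto simp: standard_extension_def)
  have AGL: "A \<in> carrier (GL d)" "B \<in> carrier (GL d)"
    using GL[OF ext, of lb3_sigma1] GL[OF ext, of lb3_sigma2] sigma[OF ext] by auto
  then have A: "A \<in> carrier_mat d d" and B: "B \<in> carrier_mat d d" by (auto dest: carrier_GL)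
  have braid: "A * B * A = B * A * B"
    using arg_cong[OF lb3_relations(1), of \<rho>s] by (simp add: mult[OF ext] sigma[OF ext])
  define C D where "C = A * B" and "D = B * A * (A * B)"
  have C: "C \<in> carrier_mat d d" and D: "D \<in> carrier_mat d d"
    unfolding C_def D_def using A B by (auto intro!: mult_carrier_mat[of _ d d])
  have scalar: "(k * k * k) \<cdot>\<^sub>m (D * (A * A)) = 1\<^sub>m d"
  proof -
    have "\<rho> \<in> hom B3 (GL d)" using assms(1) by (simp add: reps_def)
    then have "\<rho> (b3_sigma1 \<otimes>\<^bsub>B3\<^esub> b3_sigma2) = C"
      unfolding C_def assms(2,3)[symmetric]
      by (subst hom_mult) (auto simp: GL_simps B3_def b3_sigma1_def b3_sigma2_def gen_closed)
    then have s: "\<rho>s lb3_s1 * \<rho>s lb3_s2 = k \<cdot>\<^sub>m C" using k by (simp add: mult[OF ext])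
    let ?t = "lb3_s1 \<otimes>\<^bsub>LB3\<^esub> lb3_s2"
    \<comment> \<open>The cube regroups as (s_1 s_2 s_1)(s_2 s_1 s_2). By the braid relation this is
      the square of s_1 s_2 s_1, which collapses from the middle outwards.\<close>
    have "?t \<otimes>\<^bsub>LB3\<^esub> ?t \<otimes>\<^bsub>LB3\<^esub> ?t =
        (lb3_s1 \<otimes>\<^bsub>LB3\<^esub> lb3_s2 \<otimes>\<^bsub>LB3\<^esub> lb3_s1) \<otimes>\<^bsub>LB3\<^esub> (lb3_s2 \<otimes>\<^bsub>LB3\<^esub> lb3_s1 \<otimes>\<^bsub>LB3\<^esub> lb3_s2)"
      by (simp add: LB3.m_assoc)
    also have "\<dots> = (lb3_s1 \<otimes>\<^bsub>LB3\<^esub> lb3_s2 \<otimes>\<^bsub>LB3\<^esub> lb3_s1) \<otimes>\<^bsub>LB3\<^esub> (lb3_s1 \<otimes>\<^bsub>LB3\<^esub> lb3_s2 \<otimes>\<^bsub>LB3\<^esub> lb3_s1)"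
      by (simp only: lb3_relations(2))
    also have "\<dots> = lb3_s1 \<otimes>\<^bsub>LB3\<^esub> (lb3_s2 \<otimes>\<^bsub>LB3\<^esub> ((lb3_s1 \<otimes>\<^bsub>LB3\<^esub> lb3_s1) \<otimes>\<^bsub>LB3\<^esub> lb3_s2)) \<otimes>\<^bsub>LB3\<^esub> lb3_s1"
      by (simp add: LB3.m_assoc)
    also have "\<dots> = \<one>\<^bsub>LB3\<^esub>" by (simp add: lb3_relations(3,4))
    finally have cube: "?t \<otimes>\<^bsub>LB3\<^esub> ?t \<otimes>\<^bsub>LB3\<^esub> ?t = \<one>\<^bsub>LB3\<^esub>" .
    have "(k \<cdot>\<^sub>m C) * (k \<cdot>\<^sub>m C) * (k \<cdot>\<^sub>m C) = 1\<^sub>m d"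
      using arg_cong[OF cube, of \<rho>s] unfolding one[OF ext] by (simp add: mult[OF ext] s)
    moreover have "(k \<cdot>\<^sub>m C) * (k \<cdot>\<^sub>m C) * (k \<cdot>\<^sub>m C) = (k * k * k) \<cdot>\<^sub>m (C * C * C)"
    proof -
      have CC: "C * C \<in> carrier_mat d d" using C by (intro mult_carrier_mat)
      have sq: "(k \<cdot>\<^sub>m C) * (k \<cdot>\<^sub>m C) = (k * k) \<cdot>\<^sub>m (C * C)"
        unfolding mult_smult_assoc_mat[OF C smult_carrier_mat[OF C]] mult_smult_distrib[OF C C]
        by (intro eq_matI) (simp_all add: mult.assoc del: index_mult_mat(1))
      show ?thesis
        unfolding sq mult_smult_assoc_mat[OF CC smult_carrier_mat[OF C]] mult_smult_distrib[OF CC C]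
        by (intro eq_matI) (simp_all add: mult.assoc del: index_mult_mat(1))
    qed
    ultimately show ?thesis
      using braid_identity[OF A B braid] by (simp only: C_def D_def)
  qed
  have s1: "\<rho>' lb3_s1 \<in> {S \<in> carrier_mat d d. S * S = 1\<^sub>m d \<and> A * A * S = S * (A * A)}"
    if "\<rho>' \<in> ?F" for \<rho>'
  proof -
    have ext: "extends_to_LB3 d \<rho> \<rho>'" and fac: "factors_through_SLB3 d \<rho>'" using that by auto
    let ?S = "\<rho>' lb3_s1" and ?T = "\<rho>' lb3_s2"
    have S: "?S \<in> carrier_mat d d" and T: "?T \<in> carrier_mat d d" by (simp_all add: carrier_GL GL[OF ext])
    have SS: "?S * ?S = 1\<^sub>m d"
      using arg_cong[OF lb3_relations(3), of \<rho>'] one[OF ext]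
      by (simp add: mult[OF ext])
    have r1: "A * B * ?S = ?T * A * B"
      using arg_cong[OF lb3_relations(5), of \<rho>'] by (simp add: mult[OF ext] sigma[OF ext])
    have r2: "B * A * ?T = ?S * B * A"
      using factors_through_SLB3_relation[OF fac] by (simp add: mult[OF ext] sigma[OF ext])
    have BA: "B * A \<in> carrier_mat d d" using B A by (rule mult_carrier_mat)
    \<comment> \<open>D passes S in two halves: moving AB across turns S into T, and moving BA
      across turns T back into S.\<close>
    have "D * ?S = B * A * (A * B * ?S)"
      unfolding D_def C_def[symmetric] using BA C S by (rule assoc_mult_mat)
    also have "\<dots> = B * A * (?T * (A * B))" unfolding r1 assoc[OF T A B] ..
    also have "\<dots> = B * A * ?T * C"
      unfolding C_def[symmetric] using BA T C by (rule assoc_mult_mat[symmetric])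
    also have "\<dots> = ?S * (B * A) * C" unfolding r2 assoc[OF S B A] ..
    also have "\<dots> = ?S * D"
      unfolding D_def C_def[symmetric] using S BA C by (rule assoc_mult_mat)
    finally have "D * ?S = ?S * D" .
    then have "A * A * ?S = ?S * (A * A)"
      by (rule commute_scaled_inverse[OF D mult_carrier_mat[OF A A] S _ scalar])
    with S SS show ?thesis by blast
  qed
  have "inj_on (\<lambda>\<rho>'. \<rho>' lb3_s1) ?F"
  proof (rule inj_onI)
    fix r r' assume F: "r \<in> ?F" "r' \<in> ?F" and eq: "r lb3_s1 = r' lb3_s1"
    then have ext: "extends_to_LB3 d \<rho> r" "extends_to_LB3 d \<rho> r'" by auto
    have s2: "q lb3_s2 \<otimes>\<^bsub>GL d\<^esub> (A \<otimes>\<^bsub>GL d\<^esub> B) = A * B * q lb3_s1" if "extends_to_LB3 d \<rho> q" for q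
      using arg_cong[OF lb3_relations(5), of q] carrier_GL[OF GL[OF that, of lb3_s2]] A B
      by (simp add: mult[OF that] sigma[OF that] GL_simps assoc)
    have "r lb3_s2 \<otimes>\<^bsub>GL d\<^esub> (A \<otimes>\<^bsub>GL d\<^esub> B) = r' lb3_s2 \<otimes>\<^bsub>GL d\<^esub> (A \<otimes>\<^bsub>GL d\<^esub> B)"
      unfolding s2[OF ext(1)] s2[OF ext(2)] eq ..
    then have "r lb3_s2 = r' lb3_s2"
      using AGL GL[OF ext(1)] GL[OF ext(2)] by (subst (asm) GL.right_cancel) auto
    then show "r = r'"
      using ext eq sigma[OF ext(1)] sigma[OF ext(2)]
      by (intro reps_LB3_eqI) (auto simp: extends_to_LB3_def)
  qed
  moreover have "finite ((\<lambda>\<rho>'. \<rho>' lb3_s1) ` ?F)"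
  proof (rule finite_subset[OF image_subsetI[OF s1]])
    \<comment> \<open>The assumption on negatives speaks of distinct eigenvalues. An eigenvalue
      equal to its own negative would be 0, which invertibility of A excludes.\<close>
    have "x \<noteq> - y" if "eigenvalue A x" "eigenvalue A y" for x y
    proof (cases "x = y")
      case True
      have "x \<noteq> 0" using eigenvalue_GL_nonzero[OF AGL(1)] that(1) by auto
      with True show ?thesis by simp
    qed (use assms(6) that in blast)
    then show "finite {S \<in> carrier_mat d d. S * S = 1\<^sub>m d \<and> A * A * S = S * (A * A)}"
      by (rule finite_involutions_commuting_square[OF A assms(4)])
  qed
  ultimately show ?thesis by (rule finite_imageD[rotated])
qed

end
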